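(* For every stationary Gaussian VAR as in the context and any $t,M>0$, $$P\left(\max_{1\le i,j\le kp}|\Psi_{T,i,j}-\Gamma_{i,j}|>t\right)\le2k^2p^2\left(2\exp\left(\frac{-t^2T}{8\|Q\|_{\ell_\infty}^2M^2}\right)+T\exp(-M^2/2)\right),$$ where $\|Q\|_{\ell_\infty}:=\sup_{v\in\mathbb{R}^{kp},\,\|v\|=1}\|E(Xvv'X')\|_{\ell_\infty}$ satisfies $$\|Q\|_{\ell_\infty}\le2\|\Gamma\|\sum_{i=0}^T\|F^i\|.$$
   Context: Setting (VAR model). $T\ge1$ is the sample size; $k=k_T\ge1$ and $p=p_T\ge1$ are integers that may depend on $T$. The $\mathbb{R}^k$-valued data $y_t=(y_{t,1},\dots,y_{t,k})'$, $t=1-p,\dots,T$, satisfy $y_t=\sum_{l=1}^p\Phi_l y_{t-l}+\epsilon_t$ for $t=1,\dots,T$, where $\Phi_1,\dots,\Phi_p$ are $k\times k$ matrices (possibly depending on $T$ but not on $t$), $\epsilon_t$ are i.i.d. $N_k(0,\Sigma)$, all roots of $\det(I_k-\sum_{j=1}^p\Phi_jz^j)$ lie outside the unit disc, and $(y_t)$ is the stationary causal solution (so $y_t$ is centered Gaussian and $\epsilon_t$ is independent of $y_s$, $s<t$). $F$ is the $kp\times kp$ companion matrix of the VAR. $Z_t=(y_{t-1}',\dots,y_{t-p}')'\in\mathbb{R}^{kp}$, $X=(Z_T,\dots,Z_1)'$ ($T\times kp$), $\Psi_T=\frac1TX'X$, $\Gamma=E(\Psi_T)=E(Z_tZ_t')$.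 $\|\cdot\|$ is the Euclidean norm of a vector or the spectral norm of a matrix. For a square $T\times T$ matrix $B$, $\|B\|_{\ell_\infty}=\max_{1\le t\le T}\sum_{s=1}^T|B_{t,s}|$ is the maximal absolute row sum. *)

theory Defs
  imports "HOL-Probability.Probability"
begin

section \<open>Matrices\<close>

text \<open>On \<open>real^'n^'n\<close> the library's \<open>(^)\<close> is the entrywise power, so powers with respect to
  the matrix product are defined separately.\<close>

definition matpow :: "real^'n^'n \<Rightarrow> nat \<Rightarrow> real^'n^'n" where
  "matpow A n = (((**) A) ^^ n) (mat 1)"

definition spectral_norm :: "real^'n^'m \<Rightarrow> real" where
  "spectral_norm A = onorm ((*v) A)"

text \<open>A \<open>T \<times> T\<close> matrix is a function on \<open>{1..T} \<times> {1..T}\<close>, because \<open>T\<close> also occurs as a number.\<close>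

definition linf_norm :: "nat \<Rightarrow> (nat \<Rightarrow> nat \<Rightarrow> real) \<Rightarrow> real" where
  "linf_norm T B = Max ((\<lambda>t. \<Sum>s=1..T. \<bar>B t s\<bar>) ` {1..T})"

section \<open>Gaussian laws and stationarity\<close>

text \<open>The law \<open>N(0, v)\<close> with variance \<open>v \<ge> 0\<close>; it is the Dirac measure at \<open>0\<close> if \<open>v = 0\<close>.\<close>

definition gauss :: "real \<Rightarrow> real measure" where
  "gauss v = (if v = 0 then return borel 0
              else density lborel (\<lambda>x. ennreal (normal_density 0 (sqrt v) x)))"

text \<open>\<open>X\<close> is \<open>N\<^sub>n(0, S)\<close>-distributed for a covariance matrix \<open>S\<close>, which may be singular.\<close>

definition mv_gauss :: "'a measure \<Rightarrow> real^'n^'n \<Rightarrow> ('a \<Rightarrow> real^'n) \<Rightarrow> bool" where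
  "mv_gauss P S X \<longleftrightarrow>
     transpose S = S \<and> (\<forall>u. 0 \<le> u \<bullet> (S *v u)) \<and>
     X \<in> borel_measurable P \<and>
     (\<forall>u. distr P borel (\<lambda>\<omega>. u \<bullet> X \<omega>) = gauss (u \<bullet> (S *v u)))"

definition strictly_stationary :: "'a measure \<Rightarrow> (int \<Rightarrow> 'a \<Rightarrow> 'b::topological_space) \<Rightarrow> bool" where
  "strictly_stationary P y \<longleftrightarrow>
     (\<forall>t. y t \<in> borel_measurable P) \<and>
     (\<forall>h. distr P (Pi\<^sub>M UNIV (\<lambda>_. borel)) (\<lambda>\<omega> t. y (t + h) \<omega>)
          = distr P (Pi\<^sub>M UNIV (\<lambda>_. borel)) (\<lambda>\<omega> t. y t \<omega>))"

section \<open>The stationary Gaussian VAR\<close>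

text \<open>The lag matrices are \<open>\<Phi> 1, \<dots>, \<Phi> p\<close>; other values of \<open>\<Phi>\<close> are irrelevant.\<close>

definition var_char_matrix :: "nat \<Rightarrow> (nat \<Rightarrow> real^'k^'k) \<Rightarrow> complex \<Rightarrow> complex^'k^'k" where
  "var_char_matrix p \<Phi> z =
     (\<chi> i j. (if i = j then 1 else 0) - (\<Sum>l=1..p. complex_of_real (\<Phi> l $ i $ j) * z ^ l))"

text \<open>Causality is the existence of a representation
  \<open>y\<^sub>t = \<Sum>\<^sub>j A\<^sub>j \<epsilon>\<^sub>t\<^sub>-\<^sub>j\<close> with absolutely summable coefficient matrices.\<close>

definition causal ::
  "'a measure \<Rightarrow> (int \<Rightarrow> 'a \<Rightarrow> real^'k) \<Rightarrow> (int \<Rightarrow> 'a \<Rightarrow> real^'k) \<Rightarrow> bool" where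
  "causal P \<epsilon> y \<longleftrightarrow>
     (\<exists>A :: nat \<Rightarrow> real^'k^'k. summable (\<lambda>j. spectral_norm (A j)) \<and>
        (\<forall>t. AE \<omega> in P. (\<lambda>j. A j *v \<epsilon> (t - int j) \<omega>) sums y t \<omega>))"

locale stationary_gaussian_var = prob_space P
  for P :: "'a measure" +
  fixes p :: nat
    and \<Phi> :: "nat \<Rightarrow> real^'k^'k"
    and \<Sigma> :: "real^'k^'k"
    and \<epsilon> y :: "int \<Rightarrow> 'a \<Rightarrow> real^'k"
  assumes order: "p \<ge> 1"
    and roots: "\<And>z. det (var_char_matrix p \<Phi> z) = 0 \<Longrightarrow> norm z > 1"
    and innovations_indep: "indep_vars (\<lambda>_. borel) \<epsilon> UNIV"
    and innovations_gauss: "\<And>t. mv_gauss P \<Sigma> (\<epsilon> t)"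
    and equation: "\<And>t. AE \<omega> in P. y t \<omega> = (\<Sum>l=1..p. \<Phi> l *v y (t - int l) \<omega>) + \<epsilon> t \<omega>"
    and stationary: "strictly_stationary P y"
    and causality: "causal P \<epsilon> y"

section \<open>Stacked form\<close>

text \<open>Vectors in \<open>\<real>\<^sup>k\<^sup>p\<close> have index type \<open>'p \<times> 'k\<close>, where \<open>(a, i)\<close> stands for coordinate \<open>i\<close> of the
  block of lag \<open>lag a\<close>: the \<open>l\<close>-th smallest element of the finite linear order \<open>'p\<close> has lag \<open>l\<close>.\<close>

definition lag :: "'p::{finite,linorder} \<Rightarrow> nat" where
  "lag a = card {..a}"

lemma bij_betw_lag: "bij_betw lag (UNIV :: 'p::{finite,linorder} set) {1..CARD('p)}"
proof -
  have less: "lag a < lag b" if "a < b" for a b :: 'p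
    unfolding lag_def using that by (intro psubset_card_mono) auto
  have inj: "inj (lag :: 'p \<Rightarrow> nat)"
    by (rule injI) (metis less less_irrefl linorder_neqE)
  have "lag a \<in> {1..CARD('p)}" for a :: 'p
    unfolding lag_def by (auto simp: Suc_le_eq card_gt_0_iff intro: card_mono)
  then have "range (lag :: 'p \<Rightarrow> nat) \<subseteq> {1..CARD('p)}" by auto
  moreover have "card (range (lag :: 'p \<Rightarrow> nat)) = card {1..CARD('p)}"
    using inj by (simp add: card_image)
  ultimately have "range (lag :: 'p \<Rightarrow> nat) = {1..CARD('p)}"
    by (intro card_subset_eq) auto
  with inj show ?thesis by (simp add: bij_betw_def)
qed

definition companion ::
  "(nat \<Rightarrow> real^'k^'k) \<Rightarrow> real^('p::{finite,linorder} \<times> 'k)^('p \<times> 'k)" where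
  "companion \<Phi> = (\<chi> r c. case (r, c) of ((a, i), (b, j)) \<Rightarrow>
     if lag a = 1 then \<Phi> (lag b) $ i $ j
     else if lag a = lag b + 1 \<and> i = j then 1 else 0)"

definition Z :: "(int \<Rightarrow> 'a \<Rightarrow> real^'k) \<Rightarrow> int \<Rightarrow> 'a \<Rightarrow> real^('p::{finite,linorder} \<times> 'k)" where
  "Z y t \<omega> = (\<chi> r. case r of (a, i) \<Rightarrow> y (t - int (lag a)) \<omega> $ i)"

text \<open>Row \<open>r \<in> {1..T}\<close> of \<open>X = (Z\<^sub>T, \<dots>, Z\<^sub>1)'\<close> is \<open>Z\<^sub>T\<^sub>+\<^sub>1\<^sub>-\<^sub>r\<close>.\<close>

definition X ::
  "(int \<Rightarrow> 'a \<Rightarrow> real^'k) \<Rightarrow> nat \<Rightarrow> 'a \<Rightarrow> nat \<Rightarrow> real^('p::{finite,linorder} \<times> 'k)" where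
  "X y T \<omega> r = Z y (int T + 1 - int r) \<omega>"

definition Psi ::
  "(int \<Rightarrow> 'a \<Rightarrow> real^'k) \<Rightarrow> nat \<Rightarrow> 'a \<Rightarrow> real^('p::{finite,linorder} \<times> 'k)^('p \<times> 'k)" where
  "Psi y T \<omega> = (\<chi> i j. (1 / real T) * (\<Sum>r=1..T. X y T \<omega> r $ i * X y T \<omega> r $ j))"

definition Gam ::
  "'a measure \<Rightarrow> (int \<Rightarrow> 'a \<Rightarrow> real^'k) \<Rightarrow> nat \<Rightarrow> real^('p::{finite,linorder} \<times> 'k)^('p \<times> 'k)" where
  "Gam P y T = integral\<^sup>L P (Psi y T)"

text \<open>The \<open>T \<times> T\<close> matrix \<open>E(X v v' X')\<close>; entry \<open>r\<close> of \<open>X v\<close> is the inner product of row \<open>r\<close>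
  with \<open>v\<close>.\<close>

definition EXvvX ::
  "'a measure \<Rightarrow> (int \<Rightarrow> 'a \<Rightarrow> real^'k) \<Rightarrow> nat \<Rightarrow> real^('p::{finite,linorder} \<times> 'k) \<Rightarrow> nat \<Rightarrow> nat \<Rightarrow> real"
  where
  "EXvvX P y T v r s = integral\<^sup>L P (\<lambda>\<omega>. (X y T \<omega> r \<bullet> v) * (X y T \<omega> s \<bullet> v))"

end

theory Submission
  imports Defs
begin

text \<open>For a fixed vector \<open>v\<close> the numbers \<open>S\<^sub>r = X\<^sub>r \<bullet> v\<close> form a centred Gaussian vector of length \<open>T\<close> with
covariance matrix \<open>Q = E(X v v' X')\<close>, and \<open>v \<bullet> ((\<Psi> - \<Gamma>) v)\<close> is \<open>1/T\<close> times
\<open>W = \<Sum>\<^sub>r S\<^sub>r\<^sup>2 - trace Q\<close>. A diagonal entry of the symmetric matrix \<open>\<Psi> - \<Gamma>\<close> is such a quadratic form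
at a unit vector; any other entry is, by polarization, half the difference of two of them. So a union
bound over all entries reduces the inequality to a tail bound for \<open>W\<close> (\<open>sum_squares_tail\<close>), in which
\<open>Q\<close> enters only through a bound \<open>q\<close> on its absolute row sums.

The tail bound rests on an estimate of the moment generating function that works without
diagonalizing \<open>Q\<close>. If \<open>g\<close> is a standard normal vector, then
\<open>E exp (\<theta> |S|\<^sup>2) = E exp (\<theta> g'Qg)\<close> for \<open>\<theta>\<close> of either sign: for \<open>\<theta> \<ge> 0\<close> the square is linearized by
\<open>exp (\<theta> |s|\<^sup>2) = E exp (\<surd>(2\<theta>) g \<bullet> s)\<close>, for \<open>\<theta> < 0\<close> by the corresponding Fourier transform. As
\<open>E g'Qg = trace Q\<close>, Jensen's inequality bounds the centring factor \<open>exp (- \<theta> trace Q)\<close> by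
\<open>E exp (- \<theta> h'Qh)\<close> with an independent copy \<open>h\<close> of \<open>g\<close>.
The pair \<open>a = (g + h) / \<surd>2\<close>, \<open>b = (g - h) / \<surd>2\<close> has the same law as \<open>(g, h)\<close> and turns
\<open>g'Qg - h'Qh\<close> into the bilinear form \<open>2 b'Qa\<close>; integrating over \<open>b\<close> and using \<open>|Qa| \<le> q |a|\<close>
(the Schur test) gives \<open>E exp (\<theta> W) \<le> (1 - (2 \<theta> q)\<^sup>2) powr (- T / 2)\<close> for
\<open>|2 \<theta> q| < 1\<close>. Chernoff's inequality with
\<open>\<theta> = t / (4 M\<^sup>2 q\<^sup>2)\<close> then yields the term \<open>2 exp (- t\<^sup>2 T / (8 q\<^sup>2 M\<^sup>2))\<close> as long as \<open>t < q M\<^sup>2\<close> and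
\<open>M\<^sup>2 \<ge> 4/3\<close>. If instead \<open>t \<ge> q M\<^sup>2\<close> and \<open>t \<ge> q\<close>, a deviation forces some \<open>|S\<^sub>r|\<close> above
\<open>M \<surd>q\<close>, which has probability at most \<open>T exp (- M\<^sup>2 / 2)\<close>. For \<open>M\<^sup>2 < 4/3\<close> that term is at least \<open>1\<close>
unless \<open>T = 1\<close>, and \<open>T = 1\<close> is a statement about one normal variable.

Joint normality of the \<open>S\<^sub>r\<close> comes from causality: a linear combination of values of \<open>y\<close> is an almost
sure limit of linear combinations of independent Gaussian innovations, and by Levy's uniqueness
theorem such a limit is Gaussian, with the limit of the variances as its variance. Additivity of these
variances also shows that \<open>\<epsilon>\<^sub>s\<close> is uncorrelated with \<open>y\<^sub>t\<close> for \<open>t < s\<close>. With the recursion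
\<open>Z\<^sub>t\<^sub>+\<^sub>1 = F Z\<^sub>t + (\<epsilon>\<^sub>t, 0, \<dots>, 0)\<close> and stationarity this gives \<open>E (Z\<^sub>t\<^sub>+\<^sub>h Z\<^sub>t') = F\<^sup>h \<Gamma>\<close>. Hence the entries of
\<open>Q\<close> at distance \<open>h\<close> from the diagonal are bounded by \<open>\<parallel>F\<^sup>h\<parallel> \<parallel>\<Gamma>\<parallel>\<close> when \<open>v\<close> is a unit vector, and summing a
row, in which each distance occurs at most twice, gives the bound on the norm of \<open>Q\<close>.\<close>

section \<open>The one-dimensional normal law\<close>

abbreviation "N01 \<equiv> std_normal_distribution"

lemma prob_space_N01: "prob_space N01"
  using real_dist_normal_dist unfolding real_distribution_def by blast

text \<open>Writing every centred normal law, including the degenerate one, as a scaled standard normal law avoids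
case distinctions on the variance from here on.\<close>

lemma gauss_eq_distr:
  assumes "v \<ge> 0"
  shows "gauss v = distr N01 borel (\<lambda>x. sqrt v * x)"
proof (cases "v = 0")
  case True
  interpret prob_space N01 by (rule prob_space_N01)
  show ?thesis using True by (simp add: gauss_def)
next
  case False
  interpret prob_space N01 by (rule prob_space_N01)
  have "distributed N01 lborel (\<lambda>x. x) (normal_density 0 1)"
    by (auto simp: distributed_def distr_id2 comp_def)
  from normal_density_affine[OF this, of "sqrt v" 0] False assms
  have "distributed N01 lborel (\<lambda>x. sqrt v * x) (normal_density 0 (sqrt v))" by simp
  then have "distr N01 lborel (\<lambda>x. sqrt v * x) = density lborel (normal_density 0 (sqrt v))"
    by (simp add: distributed_def)
  moreover have "distr N01 lborel (\<lambda>x. sqrt v * x) = distr N01 borel (\<lambda>x. sqrt v * x)"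
    by (intro distr_cong) auto
  ultimately show ?thesis using False by (simp add: gauss_def)
qed

lemma real_distribution_gauss: "v \<ge> 0 \<Longrightarrow> real_distribution (gauss v)"
  using prob_space.real_distribution_distr[OF prob_space_N01]
  by (simp add: gauss_eq_distr)

lemma char_gauss:
  assumes "v \<ge> 0"
  shows "char (gauss v) x = complex_of_real (exp (- (v * x\<^sup>2) / 2))"
proof -
  have "char (gauss v) x = char N01 (x * sqrt v)"
    by (simp add: gauss_eq_distr assms char_def integral_distr mult.assoc)
  also have "\<dots> = complex_of_real (exp (- (v * x\<^sup>2) / 2))"
    using assms by (simp add: char_std_normal_distribution power_mult_distrib mult.commute)
  finally show ?thesis .
qed

lemma N01_square: "integrable N01 (\<lambda>x. x\<^sup>2)" "integral\<^sup>L N01 (\<lambda>x. x\<^sup>2) = 1"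
  using std_normal_distribution_even_moments[of 1] by (simp_all add: fact_2)

lemma gauss_square:
  assumes "v \<ge> 0"
  shows "integrable (gauss v) (\<lambda>x. x\<^sup>2)" "integral\<^sup>L (gauss v) (\<lambda>x. x\<^sup>2) = v"
  using N01_square assms
  by (simp_all add: gauss_eq_distr integrable_distr_eq integral_distr power_mult_distrib)

lemma nn_integral_N01:
  assumes [measurable]: "f \<in> borel_measurable borel"
  shows "(\<integral>\<^sup>+x. f x \<partial>N01) = (\<integral>\<^sup>+x. ennreal (std_normal_density x) * f x \<partial>lborel)"
  by (simp add: nn_integral_density)

text \<open>Completing the square: multiplication by an exponential only shifts the density, up to a constant.\<close>

lemma std_normal_density_mult_exp:
  "std_normal_density x * exp (c * x) = exp (c\<^sup>2 / 2) * std_normal_density (x - c)"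
proof -
  have "- x\<^sup>2 / 2 + c * x = c\<^sup>2 / 2 + - (x - c)\<^sup>2 / 2"
    by (simp add: power2_eq_square field_simps)
  then have "exp (- x\<^sup>2 / 2) * exp (c * x) = exp (c\<^sup>2 / 2) * exp (- (x - c)\<^sup>2 / 2)"
    by (metis exp_add)
  then show ?thesis unfolding std_normal_density_def
    by (metis (no_types, lifting) mult.assoc mult.left_commute)
qed

lemma nn_integral_std_normal_density: "(\<integral>\<^sup>+x. ennreal (std_normal_density x) \<partial>lborel) = 1"
  using prob_space.emeasure_space_1[OF prob_space_N01] by (simp add: emeasure_density)

lemma N01_mgf: "(\<integral>\<^sup>+x. ennreal (exp (c * x)) \<partial>N01) = ennreal (exp (c\<^sup>2 / 2))"
proof -
  have "(\<integral>\<^sup>+x. ennreal (exp (c * x)) \<partial>N01)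
      = (\<integral>\<^sup>+x. ennreal (exp (c\<^sup>2 / 2)) * ennreal (std_normal_density (x - c)) \<partial>lborel)"
    by (subst nn_integral_N01)
      (auto simp: ennreal_mult[symmetric] std_normal_density_mult_exp)
  also have "\<dots> = ennreal (exp (c\<^sup>2 / 2)) * (\<integral>\<^sup>+x. ennreal (std_normal_density (- c + 1 * x)) \<partial>lborel)"
    by (simp add: nn_integral_cmult)
  also have "(\<integral>\<^sup>+x. ennreal (std_normal_density (- c + 1 * x)) \<partial>lborel) = 1"
    using nn_integral_real_affine[of "\<lambda>x. ennreal (std_normal_density x)" 1 "-c"]
    by (simp add: nn_integral_std_normal_density)
  finally show ?thesis by simp
qed

lemma N01_mgf_square:
  assumes "c < 1 / 2"
  shows "(\<integral>\<^sup>+x. ennreal (exp (c * x\<^sup>2)) \<partial>N01) = ennreal (1 / sqrt (1 - 2 * c))"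
proof -
  define r where "r = sqrt (1 - 2 * c)"
  have r: "r > 0" "r\<^sup>2 = 1 - 2 * c" using assms by (auto simp: r_def)
  have "std_normal_density x * exp (c * x\<^sup>2) = std_normal_density (r * x)" for x
  proof -
    have "- x\<^sup>2 / 2 + c * x\<^sup>2 = - (r * x)\<^sup>2 / 2"
      by (simp add: power_mult_distrib r algebra_simps)
    then have "exp (- x\<^sup>2 / 2) * exp (c * x\<^sup>2) = exp (- (r * x)\<^sup>2 / 2)" by (metis exp_add)
    then show ?thesis unfolding std_normal_density_def by (metis mult.assoc)
  qed
  then have "(\<integral>\<^sup>+x. ennreal (exp (c * x\<^sup>2)) \<partial>N01)
      = (\<integral>\<^sup>+x. ennreal (std_normal_density (0 + r * x)) \<partial>lborel)"
    by (subst nn_integral_N01) (auto simp: ennreal_mult[symmetric])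
  moreover have "ennreal r * (\<integral>\<^sup>+x. ennreal (std_normal_density (0 + r * x)) \<partial>lborel) = 1"
    using nn_integral_real_affine[of "\<lambda>x. ennreal (std_normal_density x)" r 0] r
    by (simp add: nn_integral_std_normal_density)
  ultimately have "ennreal r * (\<integral>\<^sup>+x. ennreal (exp (c * x\<^sup>2)) \<partial>N01) = 1" by simp
  then have "ennreal (1 / r) * (ennreal r * (\<integral>\<^sup>+x. ennreal (exp (c * x\<^sup>2)) \<partial>N01)) = ennreal (1 / r)"
    by simp
  then show ?thesis using r by (simp add: mult.assoc[symmetric] ennreal_mult[symmetric] r_def)
qed

text \<open>The cross term of \<open>(M + x)\<^sup>2\<close> has the sign of \<open>x * M\<close> and may be dropped if that is nonnegative.\<close>

lemma std_normal_density_shift_le: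
  assumes "x * M \<ge> 0"
  shows "std_normal_density (M + x) \<le> exp (- M\<^sup>2 / 2) * std_normal_density x"
proof -
  have "- (M + x)\<^sup>2 / 2 \<le> - M\<^sup>2 / 2 + - x\<^sup>2 / 2"
    using assms by (simp add: power2_eq_square field_simps)
  then have "exp (- (M + x)\<^sup>2 / 2) \<le> exp (- M\<^sup>2 / 2) * exp (- x\<^sup>2 / 2)"
    by (metis exp_add exp_le_cancel_iff)
  then have "1 / sqrt (2 * pi) * exp (- (M + x)\<^sup>2 / 2)
      \<le> 1 / sqrt (2 * pi) * (exp (- M\<^sup>2 / 2) * exp (- x\<^sup>2 / 2))"
    by (intro mult_left_mono) auto
  then show ?thesis unfolding std_normal_density_def
    by (simp add: mult_ac)
qed

text \<open>The two-sided tail without an additional factor \<open>2\<close>: shifting each half-line tail to the origin costs the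
factor \<open>exp (- M\<^sup>2 / 2)\<close>, and the two half-lines together have probability at most \<open>1\<close>.\<close>

lemma N01_tail:
  assumes "M \<ge> 0"
  shows "measure N01 {x. \<bar>x\<bar> > M} \<le> exp (- M\<^sup>2 / 2)"
proof -
  interpret prob_space N01 by (rule prob_space_N01)
  \<comment> \<open>\<open>c = 1\<close> is the right tail, \<open>c = - 1\<close> the left one\<close>
  have half: "(\<integral>\<^sup>+x. ennreal (std_normal_density x) * indicator {x. c * x > M} x \<partial>lborel)
     \<le> ennreal (exp (- M\<^sup>2 / 2)) *
       (\<integral>\<^sup>+x. ennreal (std_normal_density x) * indicator {x. c * x > 0} x \<partial>lborel)"
    if c: "c * c = 1" for c :: real
  proof -
    have cM: "c * (c * M) = M" using c by (simp add: mult.assoc[symmetric])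
    have "(\<integral>\<^sup>+x. ennreal (std_normal_density x) * indicator {x. c * x > M} x \<partial>lborel)
      = (\<integral>\<^sup>+x. ennreal (std_normal_density (c * M + x)) * indicator {x. c * x > M} (c * M + x) \<partial>lborel)"
      using nn_integral_real_affine[of "\<lambda>x. ennreal (std_normal_density x) * indicator {x. c * x > M} x" 1 "c * M"]
      by simp
    also have "\<dots> \<le> (\<integral>\<^sup>+x. ennreal (exp (- M\<^sup>2 / 2)) *
        (ennreal (std_normal_density x) * indicator {x. c * x > 0} x) \<partial>lborel)"
    proof (rule nn_integral_mono)
      fix x
      have eq: "c * (c * M + x) > M \<longleftrightarrow> c * x > 0" by (simp only: distrib_left cM) simp
      show "ennreal (std_normal_density (c * M + x)) * indicator {x. c * x > M} (c * M + x)
          \<le> ennreal (exp (- M\<^sup>2 / 2)) * (ennreal (std_normal_density x) * indicator {x. c * x > 0} x)"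
      proof (cases "c * x > 0")
        case True
        then have "0 \<le> x * (c * M)" using mult_nonneg_nonneg[of "c * x" M] assms by (simp add: mult_ac)
        from std_normal_density_shift_le[OF this]
        have "std_normal_density (c * M + x) \<le> exp (- M\<^sup>2 / 2) * std_normal_density x"
          using c by (simp add: power_mult_distrib power2_eq_square[of c])
        then show ?thesis using True by (simp add: ennreal_mult[symmetric] eq)
      qed (simp add: eq)
    qed
    also have "\<dots> = ennreal (exp (- M\<^sup>2 / 2)) *
       (\<integral>\<^sup>+x. ennreal (std_normal_density x) * indicator {x. c * x > 0} x \<partial>lborel)"
      by (rule nn_integral_cmult) measurable
    finally show ?thesis .
  qed
  have "emeasure N01 {x. \<bar>x\<bar> > M}
      = (\<integral>\<^sup>+x. ennreal (std_normal_density x) * indicator {x. 1 * x > M} x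
         + ennreal (std_normal_density x) * indicator {x. (- 1) * x > M} x \<partial>lborel)"
    using assms by (subst emeasure_density) (auto intro!: nn_integral_cong split: split_indicator)
  also have "\<dots> = (\<integral>\<^sup>+x. ennreal (std_normal_density x) * indicator {x. 1 * x > M} x \<partial>lborel)
       + (\<integral>\<^sup>+x. ennreal (std_normal_density x) * indicator {x. (- 1) * x > M} x \<partial>lborel)"
    by (rule nn_integral_add) measurable
  also have "\<dots> \<le> ennreal (exp (- M\<^sup>2 / 2)) *
       (\<integral>\<^sup>+x. ennreal (std_normal_density x) * indicator {x. 1 * x > 0} x \<partial>lborel)
     + ennreal (exp (- M\<^sup>2 / 2)) *
       (\<integral>\<^sup>+x. ennreal (std_normal_density x) * indicator {x. (- 1) * x > 0} x \<partial>lborel)"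
    by (intro add_mono half) auto
  also have "\<dots> = ennreal (exp (- M\<^sup>2 / 2)) *
     (\<integral>\<^sup>+x. ennreal (std_normal_density x) * indicator {x. 1 * x > 0} x
       + ennreal (std_normal_density x) * indicator {x. (- 1) * x > 0} x \<partial>lborel)"
    by (subst nn_integral_add) (auto simp: distrib_left)
  also have "\<dots> \<le> ennreal (exp (- M\<^sup>2 / 2)) * (\<integral>\<^sup>+x. ennreal (std_normal_density x) \<partial>lborel)"
    by (intro mult_left_mono nn_integral_mono) (auto split: split_indicator)
  finally have "emeasure N01 {x. \<bar>x\<bar> > M} \<le> ennreal (exp (- M\<^sup>2 / 2))"
    by (simp add: nn_integral_std_normal_density)
  then show ?thesis by (simp add: emeasure_eq_measure)
qed

text \<open>Invariance of the plane standard normal law under the reflection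
\<open>(x, y) \<mapsto> ((x + y) / \<surd>2, (x - y) / \<surd>2)\<close>, by two one-dimensional substitutions.\<close>

lemma N01_rotation:
  assumes f [measurable]: "case_prod f \<in> borel_measurable (borel \<Otimes>\<^sub>M borel)"
  shows "(\<integral>\<^sup>+x. \<integral>\<^sup>+y. f ((x + y) / sqrt 2) ((x - y) / sqrt 2) \<partial>N01 \<partial>N01)
       = (\<integral>\<^sup>+x. \<integral>\<^sup>+y. f x y \<partial>N01 \<partial>N01)"
proof -
  let ?\<phi> = "\<lambda>x. ennreal (std_normal_density x)"
  have s2: "sqrt 2 * sqrt 2 = (2::real)" by simp
  have dens: "std_normal_density x * std_normal_density y = exp (- (x\<^sup>2 + y\<^sup>2) / 2) / (2 * pi)" for x y
  proof -
    have "exp (- x\<^sup>2 / 2) * exp (- y\<^sup>2 / 2) = exp (- (x\<^sup>2 + y\<^sup>2) / 2)"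
      by (simp add: exp_add[symmetric] field_simps)
    moreover have "sqrt (2 * pi) * sqrt (2 * pi) = 2 * pi" by simp
    ultimately show ?thesis unfolding std_normal_density_def
      by (metis (no_types, opaque_lifting) mult.commute mult_1 times_divide_eq_left times_divide_times_eq)
  qed
  have rot: "std_normal_density ((a + b) / sqrt 2) * std_normal_density ((a - b) / sqrt 2)
      = std_normal_density a * std_normal_density b" for a b
  proof -
    have "((a + b) / sqrt 2)\<^sup>2 + ((a - b) / sqrt 2)\<^sup>2 = a\<^sup>2 + b\<^sup>2"
      by (simp add: power_divide power2_eq_square field_simps)
    then show ?thesis by (simp add: dens)
  qed
  have "(\<integral>\<^sup>+x. \<integral>\<^sup>+y. f ((x + y) / sqrt 2) ((x - y) / sqrt 2) \<partial>N01 \<partial>N01)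
     = (\<integral>\<^sup>+x. \<integral>\<^sup>+y. ?\<phi> x * ?\<phi> y * f ((x + y) / sqrt 2) ((x - y) / sqrt 2) \<partial>lborel \<partial>lborel)"
    by (simp add: nn_integral_N01 nn_integral_cmult mult.assoc)
  \<comment> \<open>for fixed \<open>x\<close> the variable \<open>y\<close> is replaced by \<open>a = (x + y) / \<surd>2\<close>\<close>
  also have "\<dots> = (\<integral>\<^sup>+x. \<integral>\<^sup>+a. ennreal (sqrt 2) *
      (?\<phi> x * ?\<phi> (- x + sqrt 2 * a) * f a (sqrt 2 * x - a)) \<partial>lborel \<partial>lborel)"
  proof (rule nn_integral_cong)
    fix x :: real
    have "(\<integral>\<^sup>+y. ?\<phi> x * ?\<phi> y * f ((x + y) / sqrt 2) ((x - y) / sqrt 2) \<partial>lborel)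
      = ennreal (sqrt 2) * (\<integral>\<^sup>+a. ?\<phi> x * ?\<phi> (- x + sqrt 2 * a) *
         f ((x + (- x + sqrt 2 * a)) / sqrt 2) ((x - (- x + sqrt 2 * a)) / sqrt 2) \<partial>lborel)"
      using nn_integral_real_affine[of "\<lambda>y. ?\<phi> x * ?\<phi> y * f ((x + y) / sqrt 2) ((x - y) / sqrt 2)" "sqrt 2" "- x"]
      by simp
    also have "\<dots> = (\<integral>\<^sup>+a. ennreal (sqrt 2) *
      (?\<phi> x * ?\<phi> (- x + sqrt 2 * a) * f a (sqrt 2 * x - a)) \<partial>lborel)"
    proof -
      have arg: "(x + (- x + sqrt 2 * a)) / sqrt 2 = a"
        "(x - (- x + sqrt 2 * a)) / sqrt 2 = sqrt 2 * x - a" for a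
      proof -
        have "x - (- x + sqrt 2 * a) = (sqrt 2 * x - a) * sqrt 2" by (simp add: algebra_simps s2)
        then show "(x - (- x + sqrt 2 * a)) / sqrt 2 = sqrt 2 * x - a" by simp
      qed simp
      show ?thesis unfolding arg
        by (subst nn_integral_cmult[symmetric]) auto
    qed
    finally show "(\<integral>\<^sup>+y. ?\<phi> x * ?\<phi> y * f ((x + y) / sqrt 2) ((x - y) / sqrt 2) \<partial>lborel) = \<dots>" .
  qed
  also have "\<dots> = (\<integral>\<^sup>+a. \<integral>\<^sup>+x. ennreal (sqrt 2) *
      (?\<phi> x * ?\<phi> (- x + sqrt 2 * a) * f a (sqrt 2 * x - a)) \<partial>lborel \<partial>lborel)"
    by (rule lborel_pair.Fubini'[symmetric]) measurable
  \<comment> \<open>for fixed \<open>a\<close> the variable \<open>x\<close> is replaced by \<open>b = \<surd>2 x - a\<close>\<close>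
  also have "\<dots> = (\<integral>\<^sup>+a. \<integral>\<^sup>+b. ?\<phi> a * ?\<phi> b * f a b \<partial>lborel \<partial>lborel)"
  proof (rule nn_integral_cong)
    fix a :: real
    have arg: "- ((a + b) / sqrt 2) + sqrt 2 * a = (a - b) / sqrt 2"
         "sqrt 2 * ((a + b) / sqrt 2) - a = b" "a / sqrt 2 + 1 / sqrt 2 * b = (a + b) / sqrt 2" for b
      by (simp_all add: field_simps s2)
    have "(\<integral>\<^sup>+x. ennreal (sqrt 2) * (?\<phi> x * ?\<phi> (- x + sqrt 2 * a) * f a (sqrt 2 * x - a)) \<partial>lborel)
       = ennreal (1 / sqrt 2) * (\<integral>\<^sup>+b. ennreal (sqrt 2) * (?\<phi> ((a + b) / sqrt 2) *
           ?\<phi> ((a - b) / sqrt 2) * f a b) \<partial>lborel)"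
      using nn_integral_real_affine[of "\<lambda>x. ennreal (sqrt 2) * (?\<phi> x * ?\<phi> (- x + sqrt 2 * a) * f a (sqrt 2 * x - a))" "1 / sqrt 2" "a / sqrt 2"]
      unfolding arg by simp
    also have "\<dots> = (\<integral>\<^sup>+b. ennreal (1 / sqrt 2) * (ennreal (sqrt 2) * (?\<phi> a * ?\<phi> b * f a b)) \<partial>lborel)"
      by (subst nn_integral_cmult[symmetric])
        (auto intro!: nn_integral_cong simp: ennreal_mult[symmetric] rot)
    also have "\<dots> = (\<integral>\<^sup>+b. ?\<phi> a * ?\<phi> b * f a b \<partial>lborel)"
      by (simp add: mult.assoc[symmetric] ennreal_mult[symmetric])
    finally show "(\<integral>\<^sup>+x. ennreal (sqrt 2) *
      (?\<phi> x * ?\<phi> (- x + sqrt 2 * a) * f a (sqrt 2 * x - a)) \<partial>lborel) = \<dots>" .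
  qed
  also have "\<dots> = (\<integral>\<^sup>+x. \<integral>\<^sup>+y. f x y \<partial>N01 \<partial>N01)"
    by (simp add: nn_integral_N01 nn_integral_cmult mult.assoc)
  finally show ?thesis .
qed

text \<open>A lower bound for the probability that \<open>x\<^sup>2\<close> is within \<open>t\<close> of its mean: the interval \<open>[\<surd>(1 - t), 1]\<close> has
length at least \<open>t / 2\<close>, and the density is at least \<open>1 / 5\<close> on it. It handles samples of size \<open>1\<close>, where the
target probability may be close to \<open>1\<close> and exponential moments say nothing.\<close>

lemma N01_small_ball:
  assumes "0 \<le> t" "t \<le> 1"
  shows "measure N01 {x. \<bar>x\<^sup>2 - 1\<bar> > t} \<le> 1 - t / 10"
proof -
  interpret prob_space N01 by (rule prob_space_N01)
  define r where "r = sqrt (1 - t)"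
  have r: "0 \<le> r" "r \<le> 1 - t / 2"
  proof -
    have "1 - t \<le> (1 - t / 2)\<^sup>2" by (simp add: power2_eq_square field_simps)
    then show "r \<le> 1 - t / 2" unfolding r_def using assms by (intro real_le_lsqrt) auto
  qed (use assms in \<open>simp add: r_def\<close>)
  have dens: "1 / 5 \<le> std_normal_density x" if "x \<in> {r..1}" for x
  proof -
    have "x\<^sup>2 \<le> 1" using that r by (simp add: power_le_one)
    have e: "exp (1 / 2) \<le> (1.65 :: real)"
    proof -
      have "exp (1 / 2 :: real) ^ 2 = exp 1" by (simp add: exp_double[symmetric])
      also have "\<dots> \<le> 1.65 ^ 2" using e_less_272 by (simp add: power2_eq_square)
      finally show ?thesis by (rule power2_le_imp_le) simp
    qed
    have "sqrt (2 * pi) \<le> 3" using pi_less_4 by (intro real_le_lsqrt) auto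
    then have "exp (1 / 2) * sqrt (2 * pi) \<le> 1.65 * 3" using e by (intro mult_mono) auto
    then have "1 / 5 \<le> 1 / (exp (1 / 2) * sqrt (2 * pi))"
      by (simp add: field_simps)
    also have "\<dots> = 1 / sqrt (2 * pi) * exp (- 1 / 2)" by (simp add: exp_minus field_simps)
    also have "\<dots> \<le> 1 / sqrt (2 * pi) * exp (- x\<^sup>2 / 2)"
      using \<open>x\<^sup>2 \<le> 1\<close> by (intro mult_left_mono) auto
    finally show ?thesis by (simp only: std_normal_density_def)
  qed
  have "ennreal (t / 10) \<le> ennreal (1 / 5) * emeasure lborel {r..1}"
    using r assms by (simp add: ennreal_mult[symmetric])
  also have "\<dots> = (\<integral>\<^sup>+x. ennreal (1 / 5) * indicator {r..1} x \<partial>lborel)"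
    by (subst nn_integral_cmult_indicator) auto
  also have "\<dots> \<le> (\<integral>\<^sup>+x. ennreal (std_normal_density x) * indicator {r..1} x \<partial>lborel)"
    using dens by (intro nn_integral_mono) (auto split: split_indicator intro: ennreal_leI)
  also have "\<dots> = emeasure N01 {r..1}" by (simp add: emeasure_density)
  finally have *: "t / 10 \<le> measure N01 {r..1}" by (simp add: emeasure_eq_measure)
  have "{x. \<bar>x\<^sup>2 - 1\<bar> > t} \<subseteq> space N01 - {r..1}"
  proof -
    have "\<bar>x\<^sup>2 - 1\<bar> \<le> t" if "x \<in> {r..1}" for x
    proof -
      have "r\<^sup>2 \<le> x\<^sup>2" "x\<^sup>2 \<le> 1" using that r by (auto intro!: power_mono power_le_one)
      moreover have "r\<^sup>2 = 1 - t" using assms by (simp add: r_def)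
      ultimately show ?thesis by (simp add: abs_le_iff)
    qed
    then show ?thesis by (auto simp: not_less[symmetric])
  qed
  then have "measure N01 {x. \<bar>x\<^sup>2 - 1\<bar> > t} \<le> measure N01 (space N01 - {r..1})"
    by (intro finite_measure_mono) auto
  also have "\<dots> = 1 - measure N01 {r..1}" by (rule prob_compl) auto
  finally show ?thesis using * by simp
qed

section \<open>Independent standard normal coordinates\<close>

abbreviation PN :: "'i set \<Rightarrow> ('i \<Rightarrow> real) measure" where
  "PN I \<equiv> Pi\<^sub>M I (\<lambda>_. N01)"

lemma prob_space_PN: "prob_space (PN I)"
  by (rule prob_space_PiM) (rule prob_space_N01)

lemma sigma_finite_N01: "sigma_finite_measure N01"
  by (rule prob_space_imp_sigma_finite) (rule prob_space_N01)

lemma sigma_finite_PN: "sigma_finite_measure (PN I)"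
  by (rule prob_space_imp_sigma_finite) (rule prob_space_PN)

lemma product_sigma_finite_N01: "product_sigma_finite (\<lambda>_. N01)"
  by (intro product_sigma_finite.intro sigma_finite_N01)

lemmas PN_nn_integral_fst = sigma_finite_measure.nn_integral_fst[OF sigma_finite_PN]
lemmas N01_nn_integral_fst = sigma_finite_measure.nn_integral_fst[OF sigma_finite_N01]

lemma PN_component: "i \<in> I \<Longrightarrow> (\<lambda>g. g i) \<in> borel_measurable (PN I)"
  using measurable_component_singleton[of i I "\<lambda>_. N01"] by simp

lemma PN_mgf:
  assumes "finite I"
  shows "(\<integral>\<^sup>+g. ennreal (exp (\<Sum>i\<in>I. c i * g i)) \<partial>PN I) = ennreal (exp ((\<Sum>i\<in>I. (c i)\<^sup>2) / 2))"
proof -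
  have "(\<integral>\<^sup>+g. ennreal (exp (\<Sum>i\<in>I. c i * g i)) \<partial>PN I)
      = (\<integral>\<^sup>+g. (\<Prod>i\<in>I. ennreal (exp (c i * g i))) \<partial>PN I)"
    using assms by (simp add: exp_sum prod_ennreal)
  also have "\<dots> = (\<Prod>i\<in>I. (\<integral>\<^sup>+x. ennreal (exp (c i * x)) \<partial>N01))"
    using assms by (intro product_sigma_finite.product_nn_integral_prod[OF product_sigma_finite_N01]) auto
  also have "\<dots> = ennreal (exp ((\<Sum>i\<in>I. (c i)\<^sup>2) / 2))"
    using assms by (simp add: N01_mgf prod_ennreal exp_sum sum_divide_distrib)
  finally show ?thesis .
qed

lemma PN_mgf_square:
  assumes "finite I" "c < 1 / 2"
  shows "(\<integral>\<^sup>+g. ennreal (exp (c * (\<Sum>i\<in>I. (g i)\<^sup>2))) \<partial>PN I)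
       = ennreal ((1 / sqrt (1 - 2 * c)) ^ card I)"
proof -
  have "(\<integral>\<^sup>+g. ennreal (exp (c * (\<Sum>i\<in>I. (g i)\<^sup>2))) \<partial>PN I)
      = (\<integral>\<^sup>+g. (\<Prod>i\<in>I. ennreal (exp (c * (g i)\<^sup>2))) \<partial>PN I)"
    using assms by (simp add: exp_sum prod_ennreal sum_distrib_left)
  also have "\<dots> = (\<Prod>i\<in>I. (\<integral>\<^sup>+x. ennreal (exp (c * x\<^sup>2)) \<partial>N01))"
    using assms by (intro product_sigma_finite.product_nn_integral_prod[OF product_sigma_finite_N01]) auto
  also have "\<dots> = ennreal ((1 / sqrt (1 - 2 * c)) ^ card I)"
    using assms by (simp add: N01_mgf_square ennreal_power)
  finally show ?thesis .
qed

text \<open>The multivariate characteristic function factorizes into one-dimensional ones.\<close>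

lemma PN_char:
  assumes "finite I"
  shows "(CLINT g|PN I. iexp (\<Sum>i\<in>I. c i * g i)) = complex_of_real (exp (- (\<Sum>i\<in>I. (c i)\<^sup>2) / 2))"
proof -
  interpret prob_space N01 by (rule prob_space_N01)
  have "(CLINT g|PN I. iexp (\<Sum>i\<in>I. c i * g i)) = (CLINT g|PN I. (\<Prod>i\<in>I. iexp (c i * g i)))"
  proof (rule Bochner_Integration.integral_cong)
    fix g :: "'a \<Rightarrow> real"
    have "\<i> * complex_of_real (\<Sum>i\<in>I. c i * g i) = (\<Sum>i\<in>I. \<i> * complex_of_real (c i * g i))"
      by (simp only: of_real_sum sum_distrib_left)
    then show "iexp (\<Sum>i\<in>I. c i * g i) = (\<Prod>i\<in>I. iexp (c i * g i))"
      using assms by (simp only: exp_sum)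
  qed simp
  also have "\<dots> = (\<Prod>i\<in>I. char N01 (c i))"
    using assms unfolding char_def
    by (intro product_sigma_finite.product_integral_prod[OF product_sigma_finite_N01]) (auto intro!: integrable_iexp simp del: of_real_mult)
  also have "\<dots> = complex_of_real (exp (- (\<Sum>i\<in>I. (c i)\<^sup>2) / 2))"
  proof -
    have "- (\<Sum>i\<in>I. (c i)\<^sup>2) / 2 = (\<Sum>i\<in>I. - ((c i)\<^sup>2) / 2)"
      by (simp add: sum_divide_distrib sum_negf)
    then have "exp (- (\<Sum>i\<in>I. (c i)\<^sup>2) / 2) = (\<Prod>i\<in>I. exp (- ((c i)\<^sup>2) / 2))"
      using assms by (simp only: exp_sum)
    then show ?thesis by (simp only: char_std_normal_distribution of_real_prod)
  qed
  finally show ?thesis .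
qed

text \<open>The product \<open>g i * g j\<close> is written as a product over all coordinates, with factors \<open>x\<^sup>2\<close>, \<open>x\<close> or \<open>1\<close>, so
that its integral factorizes.\<close>

lemma PN_covariance:
  assumes "finite I" "i \<in> I" "j \<in> I"
  shows "integrable (PN I) (\<lambda>g. g i * g j)"
    and "integral\<^sup>L (PN I) (\<lambda>g. g i * g j) = (if i = j then 1 else 0)"
proof -
  interpret N01: prob_space N01 by (rule prob_space_N01)
  define f where "f k x = (if k = i then x else 1) * (if k = j then x else (1::real))" for k x
  have eq: "g i * g j = (\<Prod>k\<in>I. f k (g k))" for g
    using assms by (simp add: f_def prod.distrib prod.delta)
  have cases: "f k = (\<lambda>x. x\<^sup>2) \<and> k = i \<and> k = j \<or> f k = (\<lambda>x. x) \<and> i \<noteq> j \<and> (k = i \<or> k = j)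
      \<or> f k = (\<lambda>x. 1) \<and> k \<noteq> i \<and> k \<noteq> j" for k
    by (auto simp: f_def fun_eq_iff power2_eq_square)
  have fi: "integrable N01 (f k)" for k
    using cases[of k] N01_square(1) integrable_std_normal_distribution_moment[of 1]
      N01.integrable_const[of "1::real"] by fastforce
  have fe: "integral\<^sup>L N01 (f k) = (if k = i then if k = j then 1 else 0 else if k = j then 0 else 1)" for k
  proof -
    have "integral\<^sup>L N01 (\<lambda>x. 1) = (1::real)" by (subst lebesgue_integral_const) (simp add: N01.prob_space del: space_density)
    then show ?thesis
      using cases[of k] N01_square(2) integral_std_normal_distribution_moment_odd[of 1] by fastforce
  qed
  show "integrable (PN I) (\<lambda>g. g i * g j)"
    unfolding eq by (intro product_sigma_finite.product_integrable_prod[OF product_sigma_finite_N01] assms fi)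
  have "integral\<^sup>L (PN I) (\<lambda>g. g i * g j) = (\<Prod>k\<in>I. integral\<^sup>L N01 (f k))"
    unfolding eq by (intro product_sigma_finite.product_integral_prod[OF product_sigma_finite_N01] assms fi)
  also have "\<dots> = (if i = j then 1 else 0)"
    using assms by (auto simp: fe intro!: prod.neutral)
  finally show "integral\<^sup>L (PN I) (\<lambda>g. g i * g j) = (if i = j then 1 else 0)" .
qed

text \<open>The 45-degree reflection on pairs of numbers and, coordinatewise, on pairs of families indexed by \<open>I\<close>.\<close>

definition rot2 :: "real \<times> real \<Rightarrow> real \<times> real" where
  "rot2 w = ((fst w + snd w) / sqrt 2, (fst w - snd w) / sqrt 2)"

definition rot :: "'i set \<Rightarrow> ('i \<Rightarrow> real) \<times> ('i \<Rightarrow> real) \<Rightarrow> ('i \<Rightarrow> real) \<times> ('i \<Rightarrow> real)" where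
  "rot I z = ((\<lambda>i\<in>I. (fst z i + snd z i) / sqrt 2), (\<lambda>i\<in>I. (fst z i - snd z i) / sqrt 2))"

text \<open>Adds the pair \<open>w\<close> as the \<open>i\<close>-th coordinates of a pair of families, the step from \<open>I\<close> to \<open>insert i I\<close>.\<close>

definition upd2 :: "'i \<Rightarrow> ('i \<Rightarrow> real) \<times> ('i \<Rightarrow> real) \<Rightarrow> real \<times> real \<Rightarrow> ('i \<Rightarrow> real) \<times> ('i \<Rightarrow> real)" where
  "upd2 i v w = ((fst v)(i := fst w), (snd v)(i := snd w))"

lemma measurable_upd2 [measurable]:
  "(\<lambda>(v, w). upd2 i v w) \<in> (PN I \<Otimes>\<^sub>M PN I) \<Otimes>\<^sub>M (N01 \<Otimes>\<^sub>M N01) \<rightarrow>\<^sub>M PN (insert i I) \<Otimes>\<^sub>M PN (insert i I)"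
  unfolding upd2_def case_prod_beta
  by (intro measurable_Pair measurable_fun_upd[where J=I]) (auto intro: measurable_compose)

lemma measurable_rot2 [measurable]: "rot2 \<in> N01 \<Otimes>\<^sub>M N01 \<rightarrow>\<^sub>M N01 \<Otimes>\<^sub>M N01"
  unfolding rot2_def by measurable

lemma measurable_rot [measurable]: "rot I \<in> PN I \<Otimes>\<^sub>M PN I \<rightarrow>\<^sub>M PN I \<Otimes>\<^sub>M PN I"
  unfolding rot_def by (intro measurable_Pair measurable_restrict) measurable

lemma rot_upd2: "i \<notin> I \<Longrightarrow> rot (insert i I) (upd2 i v w) = upd2 i (rot I v) (rot2 w)"
  unfolding rot_def upd2_def rot2_def by (auto simp: fun_eq_iff)

lemma N01_pair_rotation:
  assumes [measurable]: "f \<in> borel_measurable (N01 \<Otimes>\<^sub>M N01)"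
  shows "(\<integral>\<^sup>+w. f (rot2 w) \<partial>(N01 \<Otimes>\<^sub>M N01)) = (\<integral>\<^sup>+w. f w \<partial>(N01 \<Otimes>\<^sub>M N01))"
proof -
  have m: "f \<in> borel_measurable (borel \<Otimes>\<^sub>M borel)"
  proof -
    have "sets (N01 \<Otimes>\<^sub>M N01) = sets (borel \<Otimes>\<^sub>M borel :: (real \<times> real) measure)"
      by (intro sets_pair_measure_cong) auto
    then show ?thesis using assms measurable_cong_sets[OF _ refl] by blast
  qed
  show ?thesis
    using N01_rotation[of "\<lambda>x y. f (x, y)"] m
    by (simp add: N01_nn_integral_fst[symmetric] rot2_def)
qed

text \<open>Fubini, arranged so that the two coordinates at \<open>i\<close> come together and can be rotated as a pair.\<close>

lemma nn_integral_PN_pair_insert: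
  assumes I: "finite I" "i \<notin> I"
    and f [measurable]: "f \<in> borel_measurable (PN (insert i I) \<Otimes>\<^sub>M PN (insert i I))"
  shows "(\<integral>\<^sup>+z. f z \<partial>(PN (insert i I) \<Otimes>\<^sub>M PN (insert i I)))
       = (\<integral>\<^sup>+w. (\<integral>\<^sup>+v. f (upd2 i v w) \<partial>(PN I \<Otimes>\<^sub>M PN I)) \<partial>(N01 \<Otimes>\<^sub>M N01))"
proof -
  interpret P': sigma_finite_measure "PN (insert i I)" by (rule sigma_finite_PN)
  interpret P: sigma_finite_measure "PN I" by (rule sigma_finite_PN)
  interpret N: sigma_finite_measure N01 by (rule sigma_finite_N01)
  have NP: "pair_sigma_finite N01 (PN I)"
    by (intro pair_sigma_finite.intro sigma_finite_N01 sigma_finite_PN)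
  have [measurable]: "(\<lambda>(x, g). g(i := x)) \<in> N01 \<Otimes>\<^sub>M PN I \<rightarrow>\<^sub>M PN (insert i I)"
    unfolding case_prod_beta by (intro measurable_fun_upd[where J=I]) auto
  have "(\<integral>\<^sup>+z. f z \<partial>(PN (insert i I) \<Otimes>\<^sub>M PN (insert i I)))
      = (\<integral>\<^sup>+g. (\<integral>\<^sup>+h. f (g, h) \<partial>PN (insert i I)) \<partial>PN (insert i I))"
    by (simp add: PN_nn_integral_fst[symmetric])
  also have "\<dots> = (\<integral>\<^sup>+x. (\<integral>\<^sup>+g. (\<integral>\<^sup>+h. f (g(i := x), h) \<partial>PN (insert i I)) \<partial>PN I) \<partial>N01)"
    by (rule product_sigma_finite.product_nn_integral_insert_rev[OF product_sigma_finite_N01 I]) measurable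
  also have "\<dots> = (\<integral>\<^sup>+x. (\<integral>\<^sup>+g. (\<integral>\<^sup>+y. (\<integral>\<^sup>+h. f (g(i := x), h(i := y)) \<partial>PN I) \<partial>N01) \<partial>PN I) \<partial>N01)"
  proof (intro nn_integral_cong product_sigma_finite.product_nn_integral_insert_rev[OF product_sigma_finite_N01 I])
    fix x g assume "x \<in> space N01" "g \<in> space (PN I)"
    then have [measurable]: "g(i := x) \<in> space (PN (insert i I))"
      by (auto simp: space_PiM PiE_def extensional_def)
    show "(\<lambda>h. f (g(i := x), h)) \<in> borel_measurable (PN (insert i I))" by measurable
  qed
  also have "\<dots> = (\<integral>\<^sup>+x. (\<integral>\<^sup>+y. (\<integral>\<^sup>+g. (\<integral>\<^sup>+h. f (g(i := x), h(i := y)) \<partial>PN I) \<partial>PN I) \<partial>N01) \<partial>N01)"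
  proof (rule nn_integral_cong)
    fix x assume [measurable]: "x \<in> space N01"
    show "(\<integral>\<^sup>+g. (\<integral>\<^sup>+y. (\<integral>\<^sup>+h. f (g(i := x), h(i := y)) \<partial>PN I) \<partial>N01) \<partial>PN I)
      = (\<integral>\<^sup>+y. (\<integral>\<^sup>+g. (\<integral>\<^sup>+h. f (g(i := x), h(i := y)) \<partial>PN I) \<partial>PN I) \<partial>N01)"
      by (rule pair_sigma_finite.Fubini'[OF NP]) measurable
  qed
  also have "\<dots> = (\<integral>\<^sup>+w. (\<integral>\<^sup>+v. f (upd2 i v w) \<partial>(PN I \<Otimes>\<^sub>M PN I)) \<partial>(N01 \<Otimes>\<^sub>M N01))"
    by (simp add: PN_nn_integral_fst[symmetric] N01_nn_integral_fst[symmetric] upd2_def)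
  finally show ?thesis .
qed

text \<open>Induction on the index set: the coordinates in \<open>I\<close> are rotated by the induction hypothesis and the new
pair by the plane case.\<close>

lemma PN_rotation:
  assumes "finite I" "f \<in> borel_measurable (PN I \<Otimes>\<^sub>M PN I)"
  shows "(\<integral>\<^sup>+z. f (rot I z) \<partial>(PN I \<Otimes>\<^sub>M PN I)) = (\<integral>\<^sup>+z. f z \<partial>(PN I \<Otimes>\<^sub>M PN I))"
  using assms
proof (induction I arbitrary: f rule: finite_induct)
  case empty
  have "rot {} z = z" if "z \<in> space (PN {} \<Otimes>\<^sub>M PN {})" for z :: "('a \<Rightarrow> real) \<times> ('a \<Rightarrow> real)"
    using that by (auto simp: rot_def space_pair_measure space_PiM restrict_def)
  then show ?case by (intro nn_integral_cong) simp
next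
  case (insert i I)
  note [measurable] = insert.prems
  interpret P: sigma_finite_measure "PN I" by (rule sigma_finite_PN)
  interpret N: sigma_finite_measure N01 by (rule sigma_finite_N01)
  have VW: "pair_sigma_finite (PN I \<Otimes>\<^sub>M PN I) (N01 \<Otimes>\<^sub>M N01)"
    by (intro pair_sigma_finite.intro sigma_finite_pair_measure sigma_finite_N01 sigma_finite_PN)
  have "(\<integral>\<^sup>+z. f (rot (insert i I) z) \<partial>(PN (insert i I) \<Otimes>\<^sub>M PN (insert i I)))
     = (\<integral>\<^sup>+w. (\<integral>\<^sup>+v. f (upd2 i (rot I v) (rot2 w)) \<partial>(PN I \<Otimes>\<^sub>M PN I)) \<partial>(N01 \<Otimes>\<^sub>M N01))"
    using insert.hyps by (subst nn_integral_PN_pair_insert) (auto simp: rot_upd2)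
  also have "\<dots> = (\<integral>\<^sup>+w. (\<integral>\<^sup>+v. f (upd2 i v (rot2 w)) \<partial>(PN I \<Otimes>\<^sub>M PN I)) \<partial>(N01 \<Otimes>\<^sub>M N01))"
  proof (rule nn_integral_cong)
    fix w assume w: "w \<in> space (N01 \<Otimes>\<^sub>M N01)"
    then have [measurable]: "rot2 w \<in> space (N01 \<Otimes>\<^sub>M N01)" by (simp add: space_pair_measure)
    show "(\<integral>\<^sup>+v. f (upd2 i (rot I v) (rot2 w)) \<partial>(PN I \<Otimes>\<^sub>M PN I))
        = (\<integral>\<^sup>+v. f (upd2 i v (rot2 w)) \<partial>(PN I \<Otimes>\<^sub>M PN I))"
      by (rule insert.IH[of "\<lambda>v. f (upd2 i v (rot2 w))"]) measurable
  qed
  also have "\<dots> = (\<integral>\<^sup>+v. (\<integral>\<^sup>+w. f (upd2 i v (rot2 w)) \<partial>(N01 \<Otimes>\<^sub>M N01)) \<partial>(PN I \<Otimes>\<^sub>M PN I))"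
    by (rule pair_sigma_finite.Fubini'[OF VW]) measurable
  also have "\<dots> = (\<integral>\<^sup>+v. (\<integral>\<^sup>+w. f (upd2 i v w) \<partial>(N01 \<Otimes>\<^sub>M N01)) \<partial>(PN I \<Otimes>\<^sub>M PN I))"
  proof (rule nn_integral_cong)
    fix v assume [measurable]: "v \<in> space (PN I \<Otimes>\<^sub>M PN I)"
    show "(\<integral>\<^sup>+w. f (upd2 i v (rot2 w)) \<partial>(N01 \<Otimes>\<^sub>M N01)) = (\<integral>\<^sup>+w. f (upd2 i v w) \<partial>(N01 \<Otimes>\<^sub>M N01))"
      by (rule N01_pair_rotation[of "\<lambda>w. f (upd2 i v w)"]) measurable
  qed
  also have "\<dots> = (\<integral>\<^sup>+w. (\<integral>\<^sup>+v. f (upd2 i v w) \<partial>(PN I \<Otimes>\<^sub>M PN I)) \<partial>(N01 \<Otimes>\<^sub>M N01))"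
    by (rule pair_sigma_finite.Fubini'[OF VW, symmetric]) measurable
  also have "\<dots> = (\<integral>\<^sup>+z. f z \<partial>(PN (insert i I) \<Otimes>\<^sub>M PN (insert i I)))"
    using insert.hyps by (subst nn_integral_PN_pair_insert) auto
  finally show ?case .
qed

section \<open>Gaussian quadratic forms\<close>

definition qform :: "'i set \<Rightarrow> ('i \<Rightarrow> 'i \<Rightarrow> real) \<Rightarrow> ('i \<Rightarrow> real) \<Rightarrow> real" where
  "qform I Q u = (\<Sum>i\<in>I. \<Sum>j\<in>I. u i * Q i j * u j)"

lemma qform_scale: "qform I Q (\<lambda>i. c * u i) = c\<^sup>2 * qform I Q u"
  by (simp add: qform_def sum_distrib_left power2_eq_square algebra_simps)

lemma exp_qform_measurable: "(\<lambda>g. ennreal (exp (\<theta> * qform I Q g))) \<in> borel_measurable (PN I)"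
proof -
  note PN_component [measurable]
  show ?thesis unfolding qform_def by measurable
qed

text \<open>The function \<open>\<theta> \<mapsto> E exp (\<theta> g'Qg)\<close> for a standard normal vector \<open>g\<close>, with value \<open>\<infinity>\<close> where the
expectation diverges.\<close>

definition qmgf :: "'i set \<Rightarrow> ('i \<Rightarrow> 'i \<Rightarrow> real) \<Rightarrow> real \<Rightarrow> ennreal" where
  "qmgf I Q \<theta> = (\<integral>\<^sup>+g. ennreal (exp (\<theta> * qform I Q g)) \<partial>PN I)"

text \<open>Schur's test bounds the operator norm of a symmetric matrix by its largest absolute row sum: the
Cauchy-Schwarz inequality with weights \<open>|Q i j|\<close>, followed by summation over columns.\<close>

lemma schur_test:
  fixes Q :: "'i \<Rightarrow> 'i \<Rightarrow> real"
  assumes "finite I"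
    and sym: "\<And>i j. i \<in> I \<Longrightarrow> j \<in> I \<Longrightarrow> Q i j = Q j i"
    and rows: "\<And>i. i \<in> I \<Longrightarrow> (\<Sum>j\<in>I. \<bar>Q i j\<bar>) \<le> q"
  shows "(\<Sum>i\<in>I. (\<Sum>j\<in>I. Q i j * a j)\<^sup>2) \<le> q\<^sup>2 * (\<Sum>i\<in>I. (a i)\<^sup>2)"
proof (cases "I = {}")
  case False
  then have q: "q \<ge> 0" using rows by (meson all_not_in_conv abs_ge_zero order_trans sum_nonneg)
  have "(\<Sum>i\<in>I. (\<Sum>j\<in>I. Q i j * a j)\<^sup>2) \<le> (\<Sum>i\<in>I. q * (\<Sum>j\<in>I. \<bar>Q i j\<bar> * (a j)\<^sup>2))"
  proof (rule sum_mono)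
    fix i assume i: "i \<in> I"
    have "(\<Sum>j\<in>I. Q i j * a j)\<^sup>2 \<le> (\<Sum>j\<in>I. sqrt \<bar>Q i j\<bar> * (sqrt \<bar>Q i j\<bar> * \<bar>a j\<bar>))\<^sup>2"
    proof -
      have "\<bar>\<Sum>j\<in>I. Q i j * a j\<bar> \<le> (\<Sum>j\<in>I. \<bar>Q i j\<bar> * \<bar>a j\<bar>)"
        by (rule order_trans[OF sum_abs]) (simp add: abs_mult)
      also have "\<dots> = (\<Sum>j\<in>I. sqrt \<bar>Q i j\<bar> * (sqrt \<bar>Q i j\<bar> * \<bar>a j\<bar>))"
        by (simp add: mult.assoc[symmetric])
      finally show ?thesis by (rule power2_le_iff_abs_le[THEN iffD2, rotated])
          (auto intro!: sum_nonneg)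
    qed
    also have "\<dots> \<le> (\<Sum>j\<in>I. (sqrt \<bar>Q i j\<bar>)\<^sup>2) * (\<Sum>j\<in>I. (sqrt \<bar>Q i j\<bar> * \<bar>a j\<bar>)\<^sup>2)"
      by (rule Cauchy_Schwarz_ineq_sum)
    also have "\<dots> = (\<Sum>j\<in>I. \<bar>Q i j\<bar>) * (\<Sum>j\<in>I. \<bar>Q i j\<bar> * (a j)\<^sup>2)"
      by (simp add: power_mult_distrib)
    also have "\<dots> \<le> q * (\<Sum>j\<in>I. \<bar>Q i j\<bar> * (a j)\<^sup>2)"
      using rows[OF i] by (intro mult_right_mono sum_nonneg) auto
    finally show "(\<Sum>j\<in>I. Q i j * a j)\<^sup>2 \<le> q * (\<Sum>j\<in>I. \<bar>Q i j\<bar> * (a j)\<^sup>2)" .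
  qed
  also have "\<dots> = q * (\<Sum>j\<in>I. (\<Sum>i\<in>I. \<bar>Q j i\<bar>) * (a j)\<^sup>2)"
    by (subst sum_distrib_left[symmetric], subst sum.swap) (simp add: sum_distrib_right sym)
  also have "\<dots> \<le> q * (\<Sum>j\<in>I. q * (a j)\<^sup>2)"
    using rows q by (intro mult_left_mono sum_mono mult_right_mono) auto
  finally show ?thesis by (simp add: sum_distrib_left power2_eq_square mult.assoc)
qed simp

text \<open>The product is \<open>E exp (\<theta> (g'Qg - h'Qh))\<close> with \<open>g\<close>, \<open>h\<close> independent. As
\<open>g'Qg - h'Qh = (g - h)'Q(g + h)\<close>, rotation replaces the exponent by \<open>2 \<theta> b'Qa\<close>, which is linear in
\<open>b\<close>; integrating \<open>b\<close> out leaves \<open>E exp (2 \<theta>\<^sup>2 |Qa|\<^sup>2)\<close>, to which the Schur test applies.\<close>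

lemma qmgf_mult_le:
  assumes I: "finite I"
    and sym: "\<And>i j. i \<in> I \<Longrightarrow> j \<in> I \<Longrightarrow> Q i j = Q j i"
    and rows: "\<And>i. i \<in> I \<Longrightarrow> (\<Sum>j\<in>I. \<bar>Q i j\<bar>) \<le> q"
    and \<theta>: "(2 * \<theta> * q)\<^sup>2 < 1"
  shows "qmgf I Q \<theta> * qmgf I Q (- \<theta>) \<le> ennreal ((1 / sqrt (1 - (2 * \<theta> * q)\<^sup>2)) ^ card I)"
proof -
  interpret sigma_finite_measure "PN I" by (rule sigma_finite_PN)
  define f where "f z = ennreal (exp (2 * \<theta> * (\<Sum>i\<in>I. \<Sum>j\<in>I. snd z i * Q i j * fst z j)))"
    for z :: "('a \<Rightarrow> real) \<times> ('a \<Rightarrow> real)"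
  have m [measurable]: "f \<in> borel_measurable (PN I \<Otimes>\<^sub>M PN I)"
  proof -
    note PN_component [measurable]
    show ?thesis unfolding f_def by measurable
  qed
  have rot: "f (rot I (g, h)) = ennreal (exp (\<theta> * qform I Q g)) * ennreal (exp (- \<theta> * qform I Q h))" for g h
  proof -
    have "(\<Sum>i\<in>I. \<Sum>j\<in>I. h i * Q i j * g j) = (\<Sum>i\<in>I. \<Sum>j\<in>I. g i * Q i j * h j)"
      by (subst sum.swap) (simp add: sym mult_ac)
    then have "(\<Sum>i\<in>I. \<Sum>j\<in>I. (g i - h i) * Q i j * (g j + h j)) = qform I Q g - qform I Q h"
      by (simp add: qform_def algebra_simps sum.distrib sum_subtractf)
    moreover have "2 * \<theta> * (\<Sum>i\<in>I. \<Sum>j\<in>I. (g i - h i) / sqrt 2 * Q i j * ((g j + h j) / sqrt 2))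
        = \<theta> * (\<Sum>i\<in>I. \<Sum>j\<in>I. (g i - h i) * Q i j * (g j + h j))"
    proof -
      have "a / sqrt 2 * c * (b / sqrt 2) = a * c * b / 2" for a b c :: real by simp
      then show ?thesis by (simp add: sum_divide_distrib[symmetric])
    qed
    moreover have "f (rot I (g, h)) = ennreal (exp (2 * \<theta> *
        (\<Sum>i\<in>I. \<Sum>j\<in>I. (g i - h i) / sqrt 2 * Q i j * ((g j + h j) / sqrt 2))))"
      unfolding f_def rot_def fst_conv snd_conv
      by (intro arg_cong[where f="\<lambda>x. ennreal (exp (2 * \<theta> * x))"] sum.cong refl) simp
    ultimately have "f (rot I (g, h)) = ennreal (exp (\<theta> * (qform I Q g - qform I Q h)))" by metis
    also have "\<theta> * (qform I Q g - qform I Q h) = \<theta> * qform I Q g + - \<theta> * qform I Q h"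
      by (simp add: right_diff_distrib)
    finally show ?thesis by (simp only: exp_add ennreal_mult[OF exp_ge_zero exp_ge_zero])
  qed
  have inner: "(\<integral>\<^sup>+h. f (rot I (g, h)) \<partial>PN I) = ennreal (exp (\<theta> * qform I Q g)) * qmgf I Q (- \<theta>)" for g
    unfolding rot qmgf_def by (rule nn_integral_cmult[OF exp_qform_measurable])
  have "qmgf I Q \<theta> * qmgf I Q (- \<theta>)
      = (\<integral>\<^sup>+g. (\<integral>\<^sup>+h. f (rot I (g, h)) \<partial>PN I) \<partial>PN I)"
    unfolding inner qmgf_def[of I Q \<theta>] by (rule nn_integral_multc[OF exp_qform_measurable, symmetric])
  also have "\<dots> = (\<integral>\<^sup>+a. (\<integral>\<^sup>+b. f (a, b) \<partial>PN I) \<partial>PN I)"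
    using PN_rotation[OF I m] by (simp add: PN_nn_integral_fst[symmetric])
  also have "\<dots> = (\<integral>\<^sup>+a. ennreal (exp (2 * \<theta>\<^sup>2 * (\<Sum>i\<in>I. (\<Sum>j\<in>I. Q i j * a j)\<^sup>2))) \<partial>PN I)"
  proof (rule nn_integral_cong)
    fix a :: "'a \<Rightarrow> real"
    have "f (a, b) = ennreal (exp (\<Sum>i\<in>I. (2 * \<theta> * (\<Sum>j\<in>I. Q i j * a j)) * b i))" for b
      by (simp add: f_def sum_distrib_left sum_distrib_right mult_ac)
    then show "(\<integral>\<^sup>+b. f (a, b) \<partial>PN I) = ennreal (exp (2 * \<theta>\<^sup>2 * (\<Sum>i\<in>I. (\<Sum>j\<in>I. Q i j * a j)\<^sup>2)))"
      using PN_mgf[OF I, of "\<lambda>i. 2 * \<theta> * (\<Sum>j\<in>I. Q i j * a j)"]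
      by (simp add: power_mult_distrib sum_distrib_left[symmetric])
  qed
  also have "\<dots> \<le> (\<integral>\<^sup>+a. ennreal (exp ((2 * \<theta> * q)\<^sup>2 / 2 * (\<Sum>i\<in>I. (a i)\<^sup>2))) \<partial>PN I)"
  proof (intro nn_integral_mono ennreal_leI)
    fix a :: "'a \<Rightarrow> real"
    have "2 * \<theta>\<^sup>2 * (\<Sum>i\<in>I. (\<Sum>j\<in>I. Q i j * a j)\<^sup>2) \<le> 2 * \<theta>\<^sup>2 * (q\<^sup>2 * (\<Sum>i\<in>I. (a i)\<^sup>2))"
      by (intro mult_left_mono schur_test I sym rows) auto
    also have "\<dots> = (2 * \<theta> * q)\<^sup>2 / 2 * (\<Sum>i\<in>I. (a i)\<^sup>2)" by (simp add: power_mult_distrib)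
    finally show "exp (2 * \<theta>\<^sup>2 * (\<Sum>i\<in>I. (\<Sum>j\<in>I. Q i j * a j)\<^sup>2)) \<le> exp ((2 * \<theta> * q)\<^sup>2 / 2 * (\<Sum>i\<in>I. (a i)\<^sup>2))"
      by simp
  qed
  also have "\<dots> = ennreal ((1 / sqrt (1 - (2 * \<theta> * q)\<^sup>2)) ^ card I)"
    using \<theta> by (subst PN_mgf_square[OF I]) auto
  finally show ?thesis .
qed

text \<open>Jensen's inequality for the exponential function, also when the right-hand side is infinite.\<close>

lemma exp_integral_le:
  assumes "prob_space M" "integrable M f"
  shows "ennreal (exp (integral\<^sup>L M f)) \<le> (\<integral>\<^sup>+x. ennreal (exp (f x)) \<partial>M)"
proof (cases "integrable M (\<lambda>x. exp (f x))")
  case True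
  interpret prob_space M by fact
  have "exp (integral\<^sup>L M f) \<le> integral\<^sup>L M (\<lambda>x. exp (f x))"
    using jensens_inequality[where X = f and q = exp and I = UNIV] assms True exp_convex by simp
  then show ?thesis using True by (subst nn_integral_eq_integral) (auto intro: ennreal_leI)
next
  case False
  have "(\<integral>\<^sup>+x. ennreal (exp (f x)) \<partial>M) = \<infinity>"
  proof (rule ccontr)
    assume "(\<integral>\<^sup>+x. ennreal (exp (f x)) \<partial>M) \<noteq> \<infinity>"
    with assms(2) have "integrable M (\<lambda>x. exp (f x))"
      by (intro integrableI_bounded) (simp_all add: less_top)
    with False show False by contradiction
  qed
  then show ?thesis by simp
qed

text \<open>Jensen's inequality, since \<open>E g'Qg\<close> is the trace of \<open>Q\<close>.\<close>

lemma qmgf_ge: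
  assumes "finite I"
  shows "ennreal (exp (\<theta> * (\<Sum>i\<in>I. Q i i))) \<le> qmgf I Q \<theta>"
proof -
  have int: "integrable (PN I) (\<lambda>g. u * (g i * g j))" if "i \<in> I" "j \<in> I" for i j and u :: real
    using PN_covariance(1)[OF assms that] by simp
  have eq: "\<theta> * qform I Q g = (\<Sum>i\<in>I. \<Sum>j\<in>I. (\<theta> * Q i j) * (g i * g j))" for g
    by (simp add: qform_def sum_distrib_left mult_ac)
  have fin: "integrable (PN I) (\<lambda>g. \<theta> * qform I Q g)"
    unfolding eq by (intro Bochner_Integration.integrable_sum int)
  have mean: "(\<integral>g. \<theta> * qform I Q g \<partial>PN I) = \<theta> * (\<Sum>i\<in>I. Q i i)"
  proof -
    have "(\<integral>g. \<theta> * qform I Q g \<partial>PN I) = (\<Sum>i\<in>I. \<Sum>j\<in>I. \<integral>g. (\<theta> * Q i j) * (g i * g j) \<partial>PN I)"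
      unfolding eq
      by (subst Bochner_Integration.integral_sum, intro Bochner_Integration.integrable_sum int, assumption+)
        (intro sum.cong refl Bochner_Integration.integral_sum int, assumption+)
    also have "\<dots> = (\<Sum>i\<in>I. \<Sum>j\<in>I. (\<theta> * Q i j) * (if i = j then 1 else 0))"
      using assms by (intro sum.cong refl) (simp add: PN_covariance(2))
    also have "\<dots> = \<theta> * (\<Sum>i\<in>I. Q i i)"
      using assms by (simp add: sum_distrib_left if_distrib[of "\<lambda>x. _ * x"] cong: if_cong)
    finally show ?thesis .
  qed
  show ?thesis
    using exp_integral_le[OF prob_space_PN fin] by (simp only: mean qmgf_def)
qed

section \<open>Sums of squares of a Gaussian family\<close>

text \<open>A centred Gaussian vector \<open>(S i)\<^sub>i\<^sub>\<in>\<^sub>I\<close> with covariance matrix \<open>Q\<close>, given by the laws of its linear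
combinations. The index set is a set, so that its size can be a number.\<close>

locale gaussian_family = prob_space P for P :: "'a measure" +
  fixes I :: "'i set" and S :: "'i \<Rightarrow> 'a \<Rightarrow> real" and Q :: "'i \<Rightarrow> 'i \<Rightarrow> real"
  assumes finite_index: "finite I"
    and S_measurable [measurable]: "\<And>i. i \<in> I \<Longrightarrow> S i \<in> borel_measurable P"
    and Q_sym: "\<And>i j. i \<in> I \<Longrightarrow> j \<in> I \<Longrightarrow> Q i j = Q j i"
    and qform_nonneg: "\<And>u. qform I Q u \<ge> 0"
    and distr_lin: "\<And>u. distr P borel (\<lambda>\<omega>. \<Sum>i\<in>I. u i * S i \<omega>) = gauss (qform I Q u)"
begin

lemma lin_mgf: "(\<integral>\<^sup>+\<omega>. ennreal (exp (\<Sum>i\<in>I. u i * S i \<omega>)) \<partial>P) = ennreal (exp (qform I Q u / 2))"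
proof -
  have "(\<integral>\<^sup>+\<omega>. ennreal (exp (\<Sum>i\<in>I. u i * S i \<omega>)) \<partial>P)
      = (\<integral>\<^sup>+x. ennreal (exp x) \<partial>distr P borel (\<lambda>\<omega>. \<Sum>i\<in>I. u i * S i \<omega>))"
    by (subst nn_integral_distr) auto
  also have "\<dots> = (\<integral>\<^sup>+x. ennreal (exp (sqrt (qform I Q u) * x)) \<partial>N01)"
    unfolding distr_lin gauss_eq_distr[OF qform_nonneg] by (subst nn_integral_distr) auto
  also have "\<dots> = ennreal (exp (qform I Q u / 2))"
    by (simp add: N01_mgf qform_nonneg)
  finally show ?thesis .
qed

lemma lin_char: "(CLINT \<omega>|P. iexp (\<Sum>i\<in>I. u i * S i \<omega>)) = complex_of_real (exp (- qform I Q u / 2))"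
proof -
  have "(CLINT \<omega>|P. iexp (\<Sum>i\<in>I. u i * S i \<omega>)) = char (distr P borel (\<lambda>\<omega>. \<Sum>i\<in>I. u i * S i \<omega>)) 1"
    unfolding char_def by (subst integral_distr) auto
  then show ?thesis by (simp add: distr_lin char_gauss[OF qform_nonneg])
qed

lemma distr_component:
  assumes "i \<in> I"
  shows "Q i i \<ge> 0" "distr P borel (S i) = gauss (Q i i)"
proof -
  define u :: "'i \<Rightarrow> real" where "u j = (if j = i then 1 else 0)" for j
  have "qform I Q u = Q i i"
    using assms finite_index
    by (simp add: qform_def u_def if_distrib[of "\<lambda>x. _ * x"] if_distrib[of "\<lambda>x. x * _"] cong: if_cong)
  moreover have "(\<Sum>j\<in>I. u j * S j \<omega>) = S i \<omega>" for \<omega>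
    using assms finite_index by (simp add: u_def if_distrib[of "\<lambda>x. x * _"] cong: if_cong)
  ultimately show "Q i i \<ge> 0" "distr P borel (S i) = gauss (Q i i)"
    using qform_nonneg[of u] distr_lin[of u] by simp_all
qed

lemma prob_component:
  assumes "i \<in> I" and [measurable]: "Measurable.pred borel R"
  shows "prob {\<omega> \<in> space P. R (S i \<omega>)} = measure N01 {x. R (sqrt (Q i i) * x)}"
proof -
  have [measurable]: "S i \<in> borel_measurable P" using assms by simp
  have "prob {\<omega> \<in> space P. R (S i \<omega>)} = measure (distr P borel (S i)) {x. R x}"
  proof -
    have "{x. R x} \<in> sets borel" by measurable
    moreover have "S i -` {x. R x} \<inter> space P = {\<omega> \<in> space P. R (S i \<omega>)}" by auto
    ultimately show ?thesis
      using measure_distr[of "S i" P borel "{x. R x}"] \<open>S i \<in> borel_measurable P\<close> by presburger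
  qed
  also have "\<dots> = measure N01 {x. R (sqrt (Q i i) * x)}"
  proof -
    have "{x. R x} \<in> sets borel" by measurable
    moreover have "(\<lambda>x. sqrt (Q i i) * x) -` {x. R x} \<inter> space N01 = {x. R (sqrt (Q i i) * x)}" by auto
    moreover have "(\<lambda>x. sqrt (Q i i) * x) \<in> borel_measurable N01" by simp
    ultimately show ?thesis
      unfolding distr_component(2)[OF assms(1)] gauss_eq_distr[OF distr_component(1)[OF assms(1)]]
      using measure_distr[of "\<lambda>x. sqrt (Q i i) * x" N01 borel "{x. R x}"] by presburger
  qed
  finally show ?thesis .
qed

text \<open>Both sides are the same double integral over \<open>S\<close> and an independent standard normal vector \<open>g\<close>,
evaluated in the two possible orders. The integrand is \<open>exp (r g \<bullet> S)\<close> with \<open>r\<^sup>2 = 2 \<theta>\<close> if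
\<open>\<theta> \<ge> 0\<close>, and \<open>exp (\<i> r g \<bullet> S)\<close> with \<open>r\<^sup>2 = - 2 \<theta>\<close> otherwise.\<close>

lemma mgf_sum_squares: "(\<integral>\<^sup>+\<omega>. ennreal (exp (\<theta> * (\<Sum>i\<in>I. (S i \<omega>)\<^sup>2))) \<partial>P) = qmgf I Q \<theta>"
proof (cases "\<theta> \<ge> 0")
  case True
  note PN_component [measurable]
  have pair: "pair_sigma_finite P (PN I)"
    by (intro pair_sigma_finite.intro sigma_finite_PN prob_space_imp_sigma_finite prob_space_axioms)
  define r where "r = sqrt (2 * \<theta>)"
  have r: "r\<^sup>2 = 2 * \<theta>" using True by (simp add: r_def)
  have "(\<integral>\<^sup>+\<omega>. ennreal (exp (\<theta> * (\<Sum>i\<in>I. (S i \<omega>)\<^sup>2))) \<partial>P)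
      = (\<integral>\<^sup>+\<omega>. (\<integral>\<^sup>+g. ennreal (exp (\<Sum>i\<in>I. (r * S i \<omega>) * g i)) \<partial>PN I) \<partial>P)"
    by (simp add: PN_mgf[OF finite_index] power_mult_distrib r sum_distrib_left[symmetric])
  also have "\<dots> = (\<integral>\<^sup>+g. (\<integral>\<^sup>+\<omega>. ennreal (exp (\<Sum>i\<in>I. (r * S i \<omega>) * g i)) \<partial>P) \<partial>PN I)"
    by (rule pair_sigma_finite.Fubini'[OF pair, symmetric]) measurable
  also have "\<dots> = (\<integral>\<^sup>+g. (\<integral>\<^sup>+\<omega>. ennreal (exp (\<Sum>i\<in>I. (r * g i) * S i \<omega>)) \<partial>P) \<partial>PN I)"
    by (simp only: mult_ac)
  also have "\<dots> = qmgf I Q \<theta>"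
    by (simp only: lin_mgf qform_scale r qmgf_def) simp
  finally show ?thesis .
next
  case False
  note PN_component [measurable]
  interpret PN: prob_space "PN I" by (rule prob_space_PN)
  interpret pair: pair_prob_space P "PN I" by unfold_locales
  define r where "r = sqrt (- 2 * \<theta>)"
  have r: "r\<^sup>2 = - 2 * \<theta>" using False by (simp add: r_def)
  have neg: "\<theta> * (\<Sum>i\<in>I. (S i \<omega>)\<^sup>2) \<le> 0" for \<omega>
    using False by (intro mult_nonpos_nonneg sum_nonneg) auto
  have neg': "\<theta> * qform I Q g \<le> 0" for g
    using False qform_nonneg by (intro mult_nonpos_nonneg) auto
  have int: "integrable (P \<Otimes>\<^sub>M PN I) (\<lambda>(\<omega>, g). iexp (\<Sum>i\<in>I. (r * S i \<omega>) * g i))"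
    by (rule pair.P.integrable_const_bound[of _ 1]) (auto simp: case_prod_beta)
  have "complex_of_real (\<integral>\<omega>. exp (\<theta> * (\<Sum>i\<in>I. (S i \<omega>)\<^sup>2)) \<partial>P)
      = (CLINT \<omega>|P. complex_of_real (exp (\<theta> * (\<Sum>i\<in>I. (S i \<omega>)\<^sup>2))))"
    by (rule integral_complex_of_real[symmetric])
  also have "\<dots> = (CLINT \<omega>|P. (CLINT g|PN I. iexp (\<Sum>i\<in>I. (r * S i \<omega>) * g i)))"
  proof -
    have "(\<Sum>i\<in>I. (r * S i \<omega>)\<^sup>2) = r\<^sup>2 * (\<Sum>i\<in>I. (S i \<omega>)\<^sup>2)" for \<omega>
      by (simp only: power_mult_distrib sum_distrib_left)
    then show ?thesis unfolding PN_char[OF finite_index] by (simp add: r)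
  qed
  also have "\<dots> = (CLINT g|PN I. (CLINT \<omega>|P. iexp (\<Sum>i\<in>I. (r * S i \<omega>) * g i)))"
    by (rule pair.Fubini_integral[OF int, symmetric])
  also have "\<dots> = (CLINT g|PN I. (CLINT \<omega>|P. iexp (\<Sum>i\<in>I. (r * g i) * S i \<omega>)))"
    by (simp only: mult_ac)
  also have "\<dots> = (CLINT g|PN I. complex_of_real (exp (\<theta> * qform I Q g)))"
    unfolding lin_char by (simp add: qform_scale r)
  also have "\<dots> = complex_of_real (\<integral>g. exp (\<theta> * qform I Q g) \<partial>PN I)"
    by (rule integral_complex_of_real)
  finally have eq: "(\<integral>\<omega>. exp (\<theta> * (\<Sum>i\<in>I. (S i \<omega>)\<^sup>2)) \<partial>P) = (\<integral>g. exp (\<theta> * qform I Q g) \<partial>PN I)"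
    by (simp only: of_real_eq_iff)
  have "integrable P (\<lambda>\<omega>. exp (\<theta> * (\<Sum>i\<in>I. (S i \<omega>)\<^sup>2)))"
    by (rule integrable_const_bound[of _ 1]) (auto simp: neg)
  moreover have "integrable (PN I) (\<lambda>g. exp (\<theta> * qform I Q g))"
  proof (rule PN.integrable_const_bound[of _ 1])
    show "(\<lambda>g. exp (\<theta> * qform I Q g)) \<in> borel_measurable (PN I)"
      unfolding qform_def by measurable
  qed (auto simp: neg')
  ultimately show ?thesis
    unfolding qmgf_def by (simp add: nn_integral_eq_integral eq)
qed

text \<open>With a sign \<open>\<sigma>\<close> for the two tails, \<open>E exp (\<sigma> \<theta> W) = exp (- \<sigma> \<theta> trace Q) * qmgf (\<sigma> \<theta>)\<close> is at most
\<open>qmgf (- \<sigma> \<theta>) * qmgf (\<sigma> \<theta>)\<close> by Jensen's inequality, a bound that is the same for both signs.\<close>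

lemma chernoff_sum_squares:
  assumes rows: "\<And>i. i \<in> I \<Longrightarrow> (\<Sum>j\<in>I. \<bar>Q i j\<bar>) \<le> q"
    and \<theta>: "\<theta> \<ge> 0" "(2 * \<theta> * q)\<^sup>2 < 1"
  shows "prob {\<omega> \<in> space P. \<bar>(\<Sum>i\<in>I. (S i \<omega>)\<^sup>2) - (\<Sum>i\<in>I. Q i i)\<bar> > s}
       \<le> 2 * (exp (- \<theta> * s) * (1 / sqrt (1 - (2 * \<theta> * q)\<^sup>2)) ^ card I)"
proof -
  define W where "W \<omega> = (\<Sum>i\<in>I. (S i \<omega>)\<^sup>2) - (\<Sum>i\<in>I. Q i i)" for \<omega>
  define K where "K = (1 / sqrt (1 - (2 * \<theta> * q)\<^sup>2)) ^ card I"
  have [measurable]: "W \<in> borel_measurable P" unfolding W_def by measurable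
  have K: "K \<ge> 0" using \<theta> by (simp add: K_def)
  have one: "prob {\<omega> \<in> space P. \<sigma> * W \<omega> > s} \<le> exp (- \<theta> * s) * K" if \<sigma>: "\<sigma> * \<sigma> = 1" for \<sigma> :: real
  proof -
    have sq: "(2 * (\<sigma> * \<theta>) * q)\<^sup>2 = (2 * \<theta> * q)\<^sup>2"
      using \<sigma> by (simp add: power_mult_distrib power2_eq_square[of \<sigma>])
    have mgf: "(\<integral>\<^sup>+\<omega>. ennreal (exp (\<theta> * (\<sigma> * W \<omega>))) \<partial>P) \<le> ennreal K"
    proof -
      have "\<theta> * (\<sigma> * W \<omega>) = - (\<sigma> * \<theta>) * (\<Sum>i\<in>I. Q i i) + \<sigma> * \<theta> * (\<Sum>i\<in>I. (S i \<omega>)\<^sup>2)" for \<omega>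
        unfolding W_def by (simp add: algebra_simps)
      then have "(\<integral>\<^sup>+\<omega>. ennreal (exp (\<theta> * (\<sigma> * W \<omega>))) \<partial>P)
          = (\<integral>\<^sup>+\<omega>. ennreal (exp (- (\<sigma> * \<theta>) * (\<Sum>i\<in>I. Q i i))) * ennreal (exp (\<sigma> * \<theta> * (\<Sum>i\<in>I. (S i \<omega>)\<^sup>2))) \<partial>P)"
        by (simp only: exp_add ennreal_mult[OF exp_ge_zero exp_ge_zero])
      also have "\<dots> = ennreal (exp (- (\<sigma> * \<theta>) * (\<Sum>i\<in>I. Q i i))) * qmgf I Q (\<sigma> * \<theta>)"
        unfolding mgf_sum_squares[symmetric] by (rule nn_integral_cmult) measurable
      also have "\<dots> \<le> qmgf I Q (- (\<sigma> * \<theta>)) * qmgf I Q (\<sigma> * \<theta>)"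
        by (intro mult_right_mono qmgf_ge finite_index) simp
      also have "\<dots> \<le> ennreal K"
      proof -
        have "(2 * (\<sigma> * \<theta>) * q)\<^sup>2 < 1" using \<theta>(2) by (simp only: sq)
        from qmgf_mult_le[OF finite_index Q_sym rows this] show ?thesis
          by (simp only: sq K_def mult.commute[of "qmgf I Q (\<sigma> * \<theta>)"])
      qed
      finally show ?thesis .
    qed
    have "emeasure P {\<omega> \<in> space P. \<sigma> * W \<omega> > s} = (\<integral>\<^sup>+\<omega>. indicator {\<omega> \<in> space P. \<sigma> * W \<omega> > s} \<omega> \<partial>P)"
      by (rule nn_integral_indicator[symmetric]) measurable
    also have "\<dots> \<le> (\<integral>\<^sup>+\<omega>. ennreal (exp (- \<theta> * s)) * ennreal (exp (\<theta> * (\<sigma> * W \<omega>))) \<partial>P)"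
    proof (rule nn_integral_mono)
      fix \<omega>
      show "indicator {\<omega> \<in> space P. \<sigma> * W \<omega> > s} \<omega> \<le> ennreal (exp (- \<theta> * s)) * ennreal (exp (\<theta> * (\<sigma> * W \<omega>)))"
      proof (cases "\<sigma> * W \<omega> > s")
        case True
        then have "0 \<le> - \<theta> * s + \<theta> * (\<sigma> * W \<omega>)" using \<theta> by (simp add: mult_left_mono)
        then have "1 \<le> exp (- \<theta> * s) * exp (\<theta> * (\<sigma> * W \<omega>))"
          by (simp only: exp_add[symmetric] one_le_exp_iff)
        then show ?thesis
          by (auto simp: ennreal_mult[symmetric] ennreal_1[symmetric] intro!: ennreal_leI split: split_indicator simp del: ennreal_1)
      qed simp
    qed
    also have "\<dots> = ennreal (exp (- \<theta> * s)) * (\<integral>\<^sup>+\<omega>. ennreal (exp (\<theta> * (\<sigma> * W \<omega>))) \<partial>P)"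
      by (rule nn_integral_cmult) measurable
    also have "\<dots> \<le> ennreal (exp (- \<theta> * s)) * ennreal K"
      by (intro mult_left_mono mgf) simp
    finally show ?thesis
      using K by (simp add: emeasure_eq_measure ennreal_mult[symmetric])
  qed
  have "prob {\<omega> \<in> space P. \<bar>W \<omega>\<bar> > s}
      \<le> prob ({\<omega> \<in> space P. 1 * W \<omega> > s} \<union> {\<omega> \<in> space P. (- 1) * W \<omega> > s})"
    by (intro finite_measure_mono) auto
  also have "\<dots> \<le> prob {\<omega> \<in> space P. 1 * W \<omega> > s} + prob {\<omega> \<in> space P. (- 1) * W \<omega> > s}"
    by (intro measure_Un_le) auto
  also have "\<dots> \<le> exp (- \<theta> * s) * K + exp (- \<theta> * s) * K"
    by (intro add_mono one) auto
  finally show ?thesis unfolding W_def K_def by simp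
qed

end

section \<open>The tail of a sum of squares\<close>

text \<open>Both thresholds of the tail bound, \<open>M\<^sup>2 = 4 / 3\<close> and \<open>t\<^sup>2 / (8 q\<^sup>2 M\<^sup>2) = 2 / 3\<close>, are chosen so that the
respective exponential is at least \<open>1 / 2\<close> below them.\<close>

lemma exp_neg_two_thirds: "1 / 2 \<le> exp (- (2 / 3) :: real)"
proof -
  have "exp (2 / 3) \<le> exp (ln (2 :: real))" using ln2_ge_two_thirds by (simp only: exp_le_cancel_iff)
  then show ?thesis by (simp add: exp_minus field_simps)
qed

text \<open>The loss in the moment generating function per coordinate. Where \<open>4 / 3\<close> comes from: the inequality
\<open>1 \<le> (1 - u\<^sup>2) * (1 + m u\<^sup>2)\<close> for all \<open>u \<le> 1 / 2\<close> amounts to \<open>m (1 - u\<^sup>2) \<ge> 1\<close>, that is, to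
\<open>m \<ge> 4 / 3\<close>.\<close>

lemma chernoff_constant:
  fixes u m :: real
  assumes "0 \<le> u" "u \<le> 1 / 2" "4 / 3 \<le> m"
  shows "1 / sqrt (1 - u\<^sup>2) \<le> exp (u\<^sup>2 * m / 2)"
proof -
  have u2: "u\<^sup>2 \<le> 1 / 4" using power_mono[of u "1 / 2" 2] assms by (simp add: power2_eq_square)
  have "1 \<le> (1 - u\<^sup>2) * (1 + u\<^sup>2 * (4 / 3))"
  proof -
    have "u\<^sup>2 * u\<^sup>2 \<le> u\<^sup>2 * (1 / 4)" using u2 by (intro mult_left_mono) auto
    then show ?thesis by (simp add: algebra_simps)
  qed
  also have "\<dots> \<le> (1 - u\<^sup>2) * exp (u\<^sup>2 * m)"
  proof (intro mult_left_mono)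
    have "1 + u\<^sup>2 * (4 / 3) \<le> 1 + u\<^sup>2 * m" using assms by (intro add_left_mono mult_left_mono) auto
    also have "\<dots> \<le> exp (u\<^sup>2 * m)" by (rule exp_ge_add_one_self)
    finally show "1 + u\<^sup>2 * (4 / 3) \<le> exp (u\<^sup>2 * m)" .
  qed (use u2 in simp)
  finally have "1 \<le> sqrt ((1 - u\<^sup>2) * exp (u\<^sup>2 * m))" by simp
  also have "\<dots> = sqrt (1 - u\<^sup>2) * exp (u\<^sup>2 * m / 2)"
  proof -
    have "exp (u\<^sup>2 * m) = (exp (u\<^sup>2 * m / 2))\<^sup>2" by (simp add: exp_double[symmetric])
    then show ?thesis by (simp add: real_sqrt_mult)
  qed
  finally have "1 \<le> sqrt (1 - u\<^sup>2) * exp (u\<^sup>2 * m / 2)" .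
  moreover have "sqrt (1 - u\<^sup>2) > 0" using u2 by simp
  ultimately show ?thesis by (simp add: field_simps)
qed

context gaussian_family
begin

lemma component_tail:
  assumes "i \<in> I" "Q i i \<le> q" "M \<ge> 0"
  shows "prob {\<omega> \<in> space P. \<bar>S i \<omega>\<bar> > M * sqrt q} \<le> exp (- M\<^sup>2 / 2)"
proof -
  interpret N01: prob_space N01 by (rule prob_space_N01)
  have "prob {\<omega> \<in> space P. \<bar>S i \<omega>\<bar> > M * sqrt q} = measure N01 {x. \<bar>sqrt (Q i i) * x\<bar> > M * sqrt q}"
    by (rule prob_component[OF assms(1)]) measurable
  also have "\<dots> \<le> measure N01 {x. \<bar>x\<bar> > M}"
  proof (rule N01.finite_measure_mono)
    show "{x. \<bar>sqrt (Q i i) * x\<bar> > M * sqrt q} \<subseteq> {x. \<bar>x\<bar> > M}"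
    proof clarify
      fix x assume *: "M * sqrt q < \<bar>sqrt (Q i i) * x\<bar>"
      show "M < \<bar>x\<bar>"
      proof (rule ccontr)
        assume "\<not> M < \<bar>x\<bar>"
        then have "sqrt (Q i i) * \<bar>x\<bar> \<le> sqrt q * M"
          using assms distr_component(1)[OF assms(1)] by (intro mult_mono) auto
        moreover have "\<bar>sqrt (Q i i) * x\<bar> = sqrt (Q i i) * \<bar>x\<bar>"
          using distr_component(1)[OF assms(1)] by (simp add: abs_mult)
        ultimately show False using * by (simp add: mult.commute)
      qed
    qed
  qed auto
  also have "\<dots> \<le> exp (- M\<^sup>2 / 2)" by (rule N01_tail[OF assms(3)])
  finally show ?thesis .
qed

lemma diagonal_le:
  assumes "i \<in> I" "(\<Sum>j\<in>I. \<bar>Q i j\<bar>) \<le> q"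
  shows "Q i i \<le> q"
proof -
  have "\<bar>Q i i\<bar> \<le> (\<Sum>j\<in>I. \<bar>Q i j\<bar>)" using assms(1) finite_index by (intro member_le_sum) auto
  then show ?thesis using assms(2) by simp
qed

text \<open>A sum of squares never falls below its mean by more than its mean, which is at most \<open>card I * q\<close>. So for
\<open>t \<ge> q\<close> only upward deviations remain, and these require one of the squares to exceed
\<open>t \<ge> q * M\<^sup>2\<close>.\<close>

lemma large_deviation_sum_squares:
  assumes diag: "\<And>i. i \<in> I \<Longrightarrow> Q i i \<le> q"
    and "q > 0" "t \<ge> q" "t \<ge> q * M\<^sup>2" "M \<ge> 0"
  shows "prob {\<omega> \<in> space P. \<bar>(\<Sum>i\<in>I. (S i \<omega>)\<^sup>2) - (\<Sum>i\<in>I. Q i i)\<bar> > real (card I) * t}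
       \<le> real (card I) * exp (- M\<^sup>2 / 2)"
proof -
  have tr: "0 \<le> (\<Sum>i\<in>I. Q i i)" "(\<Sum>i\<in>I. Q i i) \<le> real (card I) * q"
    using sum_bounded_above[of I "\<lambda>i. Q i i" q] diag distr_component(1) by (auto intro: sum_nonneg)
  have "{\<omega> \<in> space P. \<bar>(\<Sum>i\<in>I. (S i \<omega>)\<^sup>2) - (\<Sum>i\<in>I. Q i i)\<bar> > real (card I) * t}
      \<subseteq> (\<Union>i\<in>I. {\<omega> \<in> space P. \<bar>S i \<omega>\<bar> > M * sqrt q})"
  proof clarify
    fix \<omega> assume \<omega>: "\<omega> \<in> space P"
      and dev: "\<bar>(\<Sum>i\<in>I. (S i \<omega>)\<^sup>2) - (\<Sum>i\<in>I. Q i i)\<bar> > real (card I) * t"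
    have "real (card I) * q \<le> real (card I) * t" using assms by (intro mult_left_mono) auto
    moreover have "0 \<le> (\<Sum>i\<in>I. (S i \<omega>)\<^sup>2)" by (intro sum_nonneg) auto
    ultimately have big: "(\<Sum>i\<in>I. (S i \<omega>)\<^sup>2) > real (card I) * t" using dev tr by linarith
    show "\<omega> \<in> (\<Union>i\<in>I. {\<omega> \<in> space P. \<bar>S i \<omega>\<bar> > M * sqrt q})"
    proof (rule ccontr)
      assume "\<omega> \<notin> (\<Union>i\<in>I. {\<omega> \<in> space P. \<bar>S i \<omega>\<bar> > M * sqrt q})"
      then have le: "\<bar>S i \<omega>\<bar> \<le> M * sqrt q" if "i \<in> I" for i using \<omega> that by force
      have "(S i \<omega>)\<^sup>2 \<le> t" if "i \<in> I" for i
      proof -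
        have "(S i \<omega>)\<^sup>2 \<le> (M * sqrt q)\<^sup>2" using power_mono[OF le[OF that], of 2] by simp
        then show ?thesis using assms by (simp add: power_mult_distrib mult.commute)
      qed
      then have "(\<Sum>i\<in>I. (S i \<omega>)\<^sup>2) \<le> real (card I) * t"
        using sum_bounded_above[of I "\<lambda>i. (S i \<omega>)\<^sup>2" t] by simp
      with big show False by simp
    qed
  qed
  then have "prob {\<omega> \<in> space P. \<bar>(\<Sum>i\<in>I. (S i \<omega>)\<^sup>2) - (\<Sum>i\<in>I. Q i i)\<bar> > real (card I) * t}
      \<le> prob (\<Union>i\<in>I. {\<omega> \<in> space P. \<bar>S i \<omega>\<bar> > M * sqrt q})"
    by (intro finite_measure_mono) (use finite_index in \<open>auto intro!: sets.finite_UN\<close>)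
  also have "\<dots> \<le> (\<Sum>i\<in>I. prob {\<omega> \<in> space P. \<bar>S i \<omega>\<bar> > M * sqrt q})"
    by (intro finite_measure_subadditive_finite finite_index) auto
  also have "\<dots> \<le> (\<Sum>i\<in>I. exp (- M\<^sup>2 / 2))"
    using assms by (intro sum_mono component_tail) auto
  finally show ?thesis by simp
qed

lemma small_deviation_square:
  assumes "I = {i}" "Q i i \<le> q" "q > 0" "0 \<le> t" "t \<le> q"
  shows "prob {\<omega> \<in> space P. \<bar>(\<Sum>i\<in>I. (S i \<omega>)\<^sup>2) - (\<Sum>i\<in>I. Q i i)\<bar> > t} \<le> 1 - t / q / 10"
proof -
  interpret N01: prob_space N01 by (rule prob_space_N01)
  have i: "i \<in> I" using assms by simp
  have Qi: "0 \<le> Q i i" by (rule distr_component(1)[OF i])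
  have "prob {\<omega> \<in> space P. \<bar>(\<Sum>i\<in>I. (S i \<omega>)\<^sup>2) - (\<Sum>i\<in>I. Q i i)\<bar> > t}
      = prob {\<omega> \<in> space P. \<bar>(S i \<omega>)\<^sup>2 - Q i i\<bar> > t}"
    using assms(1) by simp
  also have "\<dots> = measure N01 {x. \<bar>(sqrt (Q i i) * x)\<^sup>2 - Q i i\<bar> > t}"
    by (rule prob_component[OF i]) measurable
  also have "\<dots> \<le> measure N01 {x. \<bar>x\<^sup>2 - 1\<bar> > t / q}"
  proof (rule N01.finite_measure_mono)
    show "{x. \<bar>(sqrt (Q i i) * x)\<^sup>2 - Q i i\<bar> > t} \<subseteq> {x. \<bar>x\<^sup>2 - 1\<bar> > t / q}"
    proof clarify
      fix x assume *: "\<bar>(sqrt (Q i i) * x)\<^sup>2 - Q i i\<bar> > t"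
      have "(sqrt (Q i i) * x)\<^sup>2 - Q i i = Q i i * (x\<^sup>2 - 1)"
        using Qi by (simp add: power_mult_distrib algebra_simps)
      then have "\<bar>(sqrt (Q i i) * x)\<^sup>2 - Q i i\<bar> = Q i i * \<bar>x\<^sup>2 - 1\<bar>"
        using Qi by (simp add: abs_mult)
      also have "\<dots> \<le> q * \<bar>x\<^sup>2 - 1\<bar>" using assms by (intro mult_right_mono) auto
      finally have "t < q * \<bar>x\<^sup>2 - 1\<bar>" using * by simp
      then show "t / q < \<bar>x\<^sup>2 - 1\<bar>" using assms by (simp add: field_simps)
    qed
  qed auto
  also have "\<dots> \<le> 1 - t / q / 10" using assms by (intro N01_small_ball) auto
  finally show ?thesis .
qed

text \<open>In units \<open>\<tau> = t / q\<close>: moderate deviations \<open>\<tau> < M\<^sup>2\<close> are treated by Chernoff's inequality and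
give the first term, large ones by the maximal component and give the second. For \<open>M\<^sup>2 < 4 / 3\<close> the
second term is at least \<open>1\<close> if there are two or more components. A single component is compared with the
first term if \<open>1 \<le> \<tau> < M\<^sup>2\<close>; if \<open>\<tau> < 1\<close>, either the first term is at least \<open>1\<close>, or \<open>M\<^sup>2\<close> is so small
that the small ball estimate \<open>1 - \<tau> / 10\<close> lies below \<open>1 - M\<^sup>2 / 2\<close>.\<close>

theorem sum_squares_tail:
  assumes "I \<noteq> {}" and rows: "\<And>i. i \<in> I \<Longrightarrow> (\<Sum>j\<in>I. \<bar>Q i j\<bar>) \<le> q"
    and q: "q > 0" and t: "t > 0" and M: "M > 0"
  shows "prob {\<omega> \<in> space P. \<bar>(\<Sum>i\<in>I. (S i \<omega>)\<^sup>2) - (\<Sum>i\<in>I. Q i i)\<bar> > real (card I) * t}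
       \<le> 2 * exp (- (t\<^sup>2 * real (card I)) / (8 * q\<^sup>2 * M\<^sup>2)) + real (card I) * exp (- M\<^sup>2 / 2)"
    (is "?p \<le> ?A + ?B")
proof -
  have T: "1 \<le> real (card I)" using assms(1) finite_index by (simp add: Suc_le_eq card_gt_0_iff)
  have A: "?A \<ge> 0" and B: "?B \<ge> 0" by simp_all
  have diag: "Q i i \<le> q" if "i \<in> I" for i using that rows by (intro diagonal_le)
  have M2: "M\<^sup>2 > 0" using M by simp
  define \<tau> where "\<tau> = t / q"
  have \<tau>: "\<tau> > 0" "t = q * \<tau>" using q t by (simp_all add: \<tau>_def)
  have A_eq: "?A = 2 * exp (- (\<tau>\<^sup>2 * real (card I)) / (8 * M\<^sup>2))"
    using q by (simp add: \<tau> power_mult_distrib)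
  have large: "?p \<le> real (card I) * exp (- m\<^sup>2 / 2)" if "\<tau> \<ge> 1" "\<tau> \<ge> m\<^sup>2" "m \<ge> 0" for m
    using that q by (intro large_deviation_sum_squares[where q=q] diag) (auto simp: \<tau>)
  consider "\<tau> \<ge> 1" "\<tau> \<ge> M\<^sup>2" | "M\<^sup>2 \<ge> 4 / 3" "\<tau> < M\<^sup>2" | "M\<^sup>2 < 4 / 3" "card I \<noteq> 1"
    | "card I = 1" "\<tau> \<ge> 1" "\<tau> < M\<^sup>2" | "card I = 1" "\<tau> < 1" by linarith
  then show ?thesis
  proof cases
    case 1
    then show ?thesis using large[of M] M A by linarith
  next
    case 2
    \<comment> \<open>\<open>\<theta>\<close> is such that half of the exponent \<open>\<theta> * card I * t\<close> pays for the moment generating function\<close>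
    define u where "u = \<tau> / (2 * M\<^sup>2)"
    define \<theta> where "\<theta> = \<tau> / (4 * M\<^sup>2 * q)"
    have u: "0 \<le> u" "u \<le> 1 / 2" "2 * \<theta> * q = u"
      using 2 \<tau> M2 q by (simp_all add: u_def \<theta>_def field_simps)
    have u2: "u\<^sup>2 < 1"
      using power_mono[of u "1 / 2" 2] u by (simp add: power2_eq_square)
    have um: "u\<^sup>2 * M\<^sup>2 / 2 = \<tau>\<^sup>2 / (8 * M\<^sup>2)"
      using M by (simp add: u_def power2_eq_square field_simps)
    have th: "\<theta> * (real (card I) * t) = real (card I) * (\<tau>\<^sup>2 / (8 * M\<^sup>2)) * 2"
      using q by (simp add: \<theta>_def \<tau>(2) power2_eq_square)
    have "?p \<le> 2 * (exp (- \<theta> * (real (card I) * t)) * (1 / sqrt (1 - u\<^sup>2)) ^ card I)"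
      using chernoff_sum_squares[OF rows, where \<theta>=\<theta> and s="real (card I) * t"] u u2 \<tau> q M2
      by (simp add: \<theta>_def)
    also have "\<dots> \<le> 2 * (exp (- \<theta> * (real (card I) * t)) * (exp (\<tau>\<^sup>2 / (8 * M\<^sup>2))) ^ card I)"
      using chernoff_constant[OF u(1,2) 2(1)] u2 unfolding um
      by (intro mult_left_mono power_mono) auto
    also have "\<dots> = ?A"
    proof -
      have "exp (- \<theta> * (real (card I) * t)) * (exp (\<tau>\<^sup>2 / (8 * M\<^sup>2))) ^ card I
          = exp (- \<theta> * (real (card I) * t) + real (card I) * (\<tau>\<^sup>2 / (8 * M\<^sup>2)))"
        by (simp only: exp_of_nat_mult[symmetric] exp_add)
      also have "- \<theta> * (real (card I) * t) + real (card I) * (\<tau>\<^sup>2 / (8 * M\<^sup>2))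
          = - (\<tau>\<^sup>2 * real (card I)) / (8 * M\<^sup>2)"
        using th by (simp add: mult.commute)
      finally show ?thesis using A_eq by simp
    qed
    finally show ?thesis using B by linarith
  next
    case 3
    then have "2 \<le> real (card I)" using T by (cases "card I") auto
    moreover have "1 / 2 \<le> exp (- M\<^sup>2 / 2)"
      using 3 by (intro order_trans[OF exp_neg_two_thirds]) simp
    ultimately have "2 * (1 / 2) \<le> ?B" by (intro mult_mono) auto
    then show ?thesis using A prob_le_1[of "{\<omega> \<in> space P. \<bar>(\<Sum>i\<in>I. (S i \<omega>)\<^sup>2) - (\<Sum>i\<in>I. Q i i)\<bar> > real (card I) * t}"] by linarith
  next
    case 4
    have "\<tau> * \<tau> / (8 * M\<^sup>2) \<le> \<tau> / 2"
    proof -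
      have "\<tau> * \<tau> \<le> \<tau> * (4 * M\<^sup>2)" using 4 \<tau> by (intro mult_left_mono) auto
      then show ?thesis using M2 by (simp add: field_simps)
    qed
    then have "exp (- \<tau> / 2) \<le> exp (- (\<tau>\<^sup>2 * real (card I)) / (8 * M\<^sup>2))"
      using 4 by (simp add: power2_eq_square)
    \<comment> \<open>the large deviation bound, with \<open>\<surd>\<tau>\<close> in place of \<open>M\<close>\<close>
    moreover have "?p \<le> exp (- \<tau> / 2)" using large[of "sqrt \<tau>"] 4 \<tau> by simp
    ultimately have "?p \<le> ?A" unfolding A_eq using exp_ge_zero[of "- (\<tau>\<^sup>2 * real (card I)) / (8 * M\<^sup>2)"] by linarith
    then show ?thesis using B by linarith
  next
    case 5
    then obtain i where i: "I = {i}" by (auto simp: card_1_singleton_iff)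
    show ?thesis
    proof (cases "\<tau>\<^sup>2 / (8 * M\<^sup>2) \<le> 2 / 3")
      case True
      then have "exp (- (2 / 3)) \<le> exp (- (\<tau>\<^sup>2 * real (card I)) / (8 * M\<^sup>2))" using 5 by simp
      then have "1 \<le> ?A" unfolding A_eq using exp_neg_two_thirds by linarith
      then show ?thesis using B prob_le_1[of "{\<omega> \<in> space P. \<bar>(\<Sum>i\<in>I. (S i \<omega>)\<^sup>2) - (\<Sum>i\<in>I. Q i i)\<bar> > real (card I) * t}"] by linarith
    next
      case False
      then have "M\<^sup>2 < 3 / 16 * \<tau>\<^sup>2" using M2 by (simp add: field_simps)
      moreover have "\<tau>\<^sup>2 \<le> \<tau>" using \<tau> 5 by (simp add: power2_eq_square mult_left_le)
      ultimately have "M\<^sup>2 / 2 \<le> \<tau> / 10" using \<tau> by linarith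
      moreover have "?p \<le> 1 - \<tau> / 10"
      proof -
        have "Q i i \<le> q" using i by (intro diag) simp
        moreover have "t \<le> q" using 5(2) q by (simp add: \<tau>_def)
        ultimately have "prob {\<omega> \<in> space P. \<bar>(\<Sum>i\<in>I. (S i \<omega>)\<^sup>2) - (\<Sum>i\<in>I. Q i i)\<bar> > t} \<le> 1 - t / q / 10"
          using q t by (intro small_deviation_square[OF i]) auto
        then show ?thesis by (simp only: 5(1) \<tau>_def of_nat_1 mult_1)
      qed
      moreover have "1 + (- M\<^sup>2 / 2) \<le> exp (- M\<^sup>2 / 2)" by (rule exp_ge_add_one_self)
      ultimately have "?p \<le> exp (- M\<^sup>2 / 2)" by linarith
      also have "\<dots> = ?B" using 5(1) by simp
      finally show ?thesis using A by linarith
    qed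
  qed
qed

end

section \<open>Gaussian laws of linear functionals of the process\<close>

text \<open>The characteristic functions \<open>exp (- v n x\<^sup>2 / 2)\<close> converge pointwise to a characteristic function, which
is continuous with value \<open>1\<close> at \<open>0\<close>. It is therefore nonzero at some \<open>x \<noteq> 0\<close>, and taking
logarithms there shows that the variances converge. Levy's uniqueness theorem identifies the limit law,
so the second moments converge without any assumption of uniform integrability.\<close>

lemma (in prob_space) AE_limit_of_gaussians:
  fixes L :: "nat \<Rightarrow> 'a \<Rightarrow> real"
  assumes meas: "\<And>n. L n \<in> borel_measurable M" "V \<in> borel_measurable M"
    and lim: "AE \<omega> in M. (\<lambda>n. L n \<omega>) \<longlonglongrightarrow> V \<omega>"
    and v: "\<And>n. v n \<ge> 0" and distr: "\<And>n. distr M borel (L n) = gauss (v n)"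
  obtains w where "w \<ge> 0" "v \<longlonglongrightarrow> w" "distr M borel V = gauss w"
proof -
  note [measurable] = meas
  interpret V: real_distribution "distr M borel V" by (rule real_distribution_distr) fact
  define \<psi> where "\<psi> = char (distr M borel V)"
  have conv: "(\<lambda>n. complex_of_real (exp (- (v n * x\<^sup>2) / 2))) \<longlonglongrightarrow> \<psi> x" for x
  proof -
    have "(\<lambda>n. CLINT \<omega>|M. iexp (x * L n \<omega>)) \<longlonglongrightarrow> (CLINT \<omega>|M. iexp (x * V \<omega>))"
    proof (rule integral_dominated_convergence[where w="\<lambda>_. 1"])
      show "AE \<omega> in M. (\<lambda>n. iexp (x * L n \<omega>)) \<longlonglongrightarrow> iexp (x * V \<omega>)"
        using lim by eventually_elim (intro tendsto_intros)
    qed (auto simp del: of_real_mult)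
    moreover have "(CLINT \<omega>|M. iexp (x * L n \<omega>)) = complex_of_real (exp (- (v n * x\<^sup>2) / 2))" for n
      using char_gauss[OF v, of n x] by (simp add: distr[symmetric] char_def integral_distr)
    moreover have "(CLINT \<omega>|M. iexp (x * V \<omega>)) = \<psi> x"
      by (simp add: \<psi>_def char_def integral_distr)
    ultimately show ?thesis by simp
  qed
  have "isCont \<psi> 0" "\<psi> 0 = 1" unfolding \<psi>_def by (rule V.isCont_char, rule V.char_zero)
  then have "(\<psi> \<longlongrightarrow> 1) (at 0)" by (simp add: isCont_def)
  then have "eventually (\<lambda>x. \<psi> x \<noteq> 0) (at 0)"
    by (rule tendsto_imp_eventually_ne) simp
  then have "eventually (\<lambda>x. x \<noteq> 0 \<and> \<psi> x \<noteq> 0) (at 0)"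
    by (intro eventually_conj eventually_neq_at_within)
  then obtain x where x: "x \<noteq> 0" "\<psi> x \<noteq> 0"
    using eventually_happens'[OF at_neq_bot] by blast
  define r where "r = Re (\<psi> x)"
  have lim_r: "(\<lambda>n. exp (- (v n * x\<^sup>2) / 2)) \<longlonglongrightarrow> r"
    using tendsto_Re[OF conv[of x]] by (simp add: r_def)
  then have "(\<lambda>n. complex_of_real (exp (- (v n * x\<^sup>2) / 2))) \<longlonglongrightarrow> complex_of_real r"
    by (intro tendsto_of_real)
  then have "\<psi> x = complex_of_real r" using LIMSEQ_unique[OF conv[of x]] by blast
  then have "r \<noteq> 0" using x by auto
  moreover have "r \<ge> 0" by (rule LIMSEQ_le_const[OF lim_r]) auto
  ultimately have r: "r > 0" by simp
  define w where "w = - 2 * ln r / x\<^sup>2"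
  have "(\<lambda>n. - 2 * ln (exp (- (v n * x\<^sup>2) / 2)) / x\<^sup>2) \<longlonglongrightarrow> w"
    unfolding w_def using r x lim_r by (intro tendsto_intros) auto
  then have vw: "v \<longlonglongrightarrow> w" using x by simp
  have w: "w \<ge> 0" by (rule LIMSEQ_le_const[OF vw]) (use v in auto)
  have "\<psi> = char (gauss w)"
  proof
    fix x
    have "(\<lambda>n. complex_of_real (exp (- (v n * x\<^sup>2) / 2))) \<longlonglongrightarrow> complex_of_real (exp (- (w * x\<^sup>2) / 2))"
      by (intro tendsto_intros vw) auto
    then show "\<psi> x = char (gauss w) x" using LIMSEQ_unique[OF conv] by (simp add: char_gauss[OF w])
  qed
  then have "distr M borel V = gauss w"
    unfolding \<psi>_def by (intro Levy_uniqueness V.real_distribution_axioms real_distribution_gauss w)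
  with w vw show thesis by (rule that)
qed

lemma (in prob_space) gauss_variable_square:
  assumes "V \<in> borel_measurable M" "distr M borel V = gauss v" "v \<ge> 0"
  shows "integrable M (\<lambda>\<omega>. (V \<omega>)\<^sup>2)" "expectation (\<lambda>\<omega>. (V \<omega>)\<^sup>2) = v"
  using gauss_square[OF assms(3)] assms(1)
  by (simp_all add: assms(2)[symmetric] integrable_distr_eq integral_distr)

lemma integrable_mult_of_squares:
  fixes V Y :: "'a \<Rightarrow> real"
  assumes [measurable]: "V \<in> borel_measurable M" "Y \<in> borel_measurable M"
    and "integrable M (\<lambda>\<omega>. (V \<omega>)\<^sup>2)" "integrable M (\<lambda>\<omega>. (Y \<omega>)\<^sup>2)"
  shows "integrable M (\<lambda>\<omega>. V \<omega> * Y \<omega>)"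
proof (rule Bochner_Integration.integrable_bound)
  show "integrable M (\<lambda>\<omega>. (V \<omega>)\<^sup>2 + (Y \<omega>)\<^sup>2)" using assms by simp
  show "AE \<omega> in M. norm (V \<omega> * Y \<omega>) \<le> norm ((V \<omega>)\<^sup>2 + (Y \<omega>)\<^sup>2)"
  proof (intro AE_I2)
    fix \<omega>
    have "2 * (\<bar>V \<omega>\<bar> * \<bar>Y \<omega>\<bar>) \<le> (V \<omega>)\<^sup>2 + (Y \<omega>)\<^sup>2"
      using sum_squares_bound[of "\<bar>V \<omega>\<bar>" "\<bar>Y \<omega>\<bar>"] by simp
    moreover have "0 \<le> \<bar>V \<omega>\<bar> * \<bar>Y \<omega>\<bar>" by simp
    ultimately have "\<bar>V \<omega>\<bar> * \<bar>Y \<omega>\<bar> \<le> \<bar>(V \<omega>)\<^sup>2 + (Y \<omega>)\<^sup>2\<bar>" by linarith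
    then show "norm (V \<omega> * Y \<omega>) \<le> norm ((V \<omega>)\<^sup>2 + (Y \<omega>)\<^sup>2)"
      by (simp only: real_norm_def abs_mult)
  qed
qed simp

context stationary_gaussian_var
begin

lemma y_measurable [measurable]: "y t \<in> borel_measurable P"
  using stationary by (simp add: strictly_stationary_def)

lemma innovation_measurable [measurable]: "\<epsilon> t \<in> borel_measurable P"
  using innovations_gauss[of t] by (simp add: mv_gauss_def)

lemma innovation_variance_nonneg: "0 \<le> d \<bullet> (\<Sigma> *v d)"
  using innovations_gauss[of 0] by (simp add: mv_gauss_def)

lemma innovation_distr: "distr P borel (\<lambda>\<omega>. d \<bullet> \<epsilon> t \<omega>) = gauss (d \<bullet> (\<Sigma> *v d))"
  using innovations_gauss[of t] by (simp add: mv_gauss_def)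

lemma innovations_combination_distr:
  assumes "finite B"
  shows "distr P borel (\<lambda>\<omega>. \<Sum>m\<in>B. b m \<bullet> \<epsilon> m \<omega>) = gauss (\<Sum>m\<in>B. b m \<bullet> (\<Sigma> *v b m))"
    (is "?D = gauss ?v")
proof (rule Levy_uniqueness)
  have v: "?v \<ge> 0" by (intro sum_nonneg innovation_variance_nonneg)
  show "real_distribution ?D" by (rule real_distribution_distr) measurable
  show "real_distribution (gauss ?v)" by (rule real_distribution_gauss[OF v])
  have "indep_vars (\<lambda>_. borel) (\<lambda>m \<omega>. b m \<bullet> \<epsilon> m \<omega>) UNIV"
    by (rule indep_vars_compose2[OF innovations_indep]) measurable
  then have indep: "indep_vars (\<lambda>_. borel) (\<lambda>m \<omega>. b m \<bullet> \<epsilon> m \<omega>) B"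
    by (rule indep_vars_subset) simp
  show "char ?D = char (gauss ?v)"
  proof
    fix x
    have "char ?D x = (\<Prod>m\<in>B. complex_of_real (exp (- (b m \<bullet> (\<Sigma> *v b m) * x\<^sup>2) / 2)))"
      unfolding char_distr_sum[OF indep] innovation_distr
      by (intro prod.cong refl char_gauss innovation_variance_nonneg)
    also have "\<dots> = complex_of_real (exp (\<Sum>m\<in>B. - (b m \<bullet> (\<Sigma> *v b m) * x\<^sup>2) / 2))"
      by (simp only: exp_sum[OF assms] of_real_prod)
    also have "(\<Sum>m\<in>B. - (b m \<bullet> (\<Sigma> *v b m) * x\<^sup>2) / 2) = - (?v * x\<^sup>2) / 2"
      by (simp add: sum_negf sum_divide_distrib sum_distrib_right)
    finally show "char ?D x = char (gauss ?v) x" by (simp only: char_gauss[OF v])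
  qed
qed

text \<open>Truncating the causal representation after \<open>n\<close> terms and collecting the coefficients of each innovation.
The times of these innovations do not exceed those of the process values, which is what makes later
innovations independent of the approximation.\<close>

lemma process_combination_approximation:
  assumes K: "finite K"
  shows "\<exists>B b. (\<forall>n. finite (B n) \<and> B n \<subseteq> (\<Union>k\<in>K. {..\<tau> k})) \<and>
    (AE \<omega> in P. (\<lambda>n. \<Sum>m\<in>B n. b n m \<bullet> \<epsilon> m \<omega>) \<longlonglongrightarrow> (\<Sum>k\<in>K. c k \<bullet> y (\<tau> k) \<omega>))"
proof -
  from causality obtain A where
    A: "\<And>t. AE \<omega> in P. (\<lambda>j. A j *v \<epsilon> (t - int j) \<omega>) sums y t \<omega>"
    unfolding causal_def by blast
  define B where "B n = (\<Union>k\<in>K. (\<lambda>j. \<tau> k - int j) ` {..<n})" for n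
  define b where "b n m = (\<Sum>k\<in>K. \<Sum>j<n. if m = \<tau> k - int j then transpose (A j) *v c k else 0)" for n m
  have fin: "finite (B n)" for n using K by (simp add: B_def)
  have eq: "(\<Sum>m\<in>B n. b n m \<bullet> \<epsilon> m \<omega>) = (\<Sum>k\<in>K. c k \<bullet> (\<Sum>j<n. A j *v \<epsilon> (\<tau> k - int j) \<omega>))" for n \<omega>
  proof -
    have "(\<Sum>m\<in>B n. b n m \<bullet> \<epsilon> m \<omega>)
        = (\<Sum>m\<in>B n. \<Sum>k\<in>K. \<Sum>j<n. (if m = \<tau> k - int j then transpose (A j) *v c k else 0) \<bullet> \<epsilon> m \<omega>)"
      by (simp add: b_def inner_sum_left)
    also have "\<dots> = (\<Sum>k\<in>K. \<Sum>j<n. \<Sum>m\<in>B n. (if m = \<tau> k - int j then transpose (A j) *v c k else 0) \<bullet> \<epsilon> m \<omega>)"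
      by (subst sum.swap, intro sum.cong refl, rule sum.swap)
    also have "\<dots> = (\<Sum>k\<in>K. \<Sum>j<n. c k \<bullet> (A j *v \<epsilon> (\<tau> k - int j) \<omega>))"
    proof (intro sum.cong refl)
      fix k j assume "k \<in> K" "j \<in> {..<n}"
      then have mem: "\<tau> k - int j \<in> B n" by (auto simp: B_def)
      have "(\<Sum>m\<in>B n. (if m = \<tau> k - int j then transpose (A j) *v c k else 0) \<bullet> \<epsilon> m \<omega>)
          = (\<Sum>m\<in>B n. if m = \<tau> k - int j then (transpose (A j) *v c k) \<bullet> \<epsilon> m \<omega> else 0)"
        by (intro sum.cong) auto
      also have "\<dots> = (transpose (A j) *v c k) \<bullet> \<epsilon> (\<tau> k - int j) \<omega>"
        using fin mem by simp
      also have "\<dots> = c k \<bullet> (A j *v \<epsilon> (\<tau> k - int j) \<omega>)"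
        by (metis dot_lmul_matrix inner_commute transpose_matrix_vector)
      finally show "(\<Sum>m\<in>B n. (if m = \<tau> k - int j then transpose (A j) *v c k else 0) \<bullet> \<epsilon> m \<omega>) = \<dots>" .
    qed
    finally show ?thesis by (simp add: inner_sum_right)
  qed
  have "AE \<omega> in P. \<forall>k\<in>K. (\<lambda>j. A j *v \<epsilon> (\<tau> k - int j) \<omega>) sums y (\<tau> k) \<omega>"
    using K A by (intro AE_finite_allI) auto
  then have "AE \<omega> in P. (\<lambda>n. \<Sum>m\<in>B n. b n m \<bullet> \<epsilon> m \<omega>) \<longlonglongrightarrow> (\<Sum>k\<in>K. c k \<bullet> y (\<tau> k) \<omega>)"
    unfolding eq by eventually_elim (intro tendsto_intros, auto simp: sums_def)
  moreover have "B n \<subseteq> (\<Union>k\<in>K. {..\<tau> k})" for n by (auto simp: B_def)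
  ultimately show ?thesis using fin by (intro exI[of _ B] exI[of _ b]) simp
qed

lemma process_combination_gauss:
  assumes K: "finite K"
  obtains v where "v \<ge> 0" "distr P borel (\<lambda>\<omega>. \<Sum>k\<in>K. c k \<bullet> y (\<tau> k) \<omega>) = gauss v"
proof -
  obtain B b where B': "\<forall>n. finite (B n) \<and> B n \<subseteq> (\<Union>k\<in>K. {..\<tau> k})"
    and B: "AE \<omega> in P. (\<lambda>n. \<Sum>m\<in>B n. b n m \<bullet> \<epsilon> m \<omega>) \<longlonglongrightarrow> (\<Sum>k\<in>K. c k \<bullet> y (\<tau> k) \<omega>)"
    using process_combination_approximation[OF K, of \<tau> c] by (elim exE conjE)
  have fin: "finite (B n)" for n using B' by simp
  show thesis
  proof (rule AE_limit_of_gaussians[OF _ _ B])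
    show "distr P borel (\<lambda>\<omega>. \<Sum>m\<in>B n. b n m \<bullet> \<epsilon> m \<omega>) = gauss (\<Sum>m\<in>B n. b n m \<bullet> (\<Sigma> *v b n m))" for n
      by (rule innovations_combination_distr[OF fin])
    show "0 \<le> (\<Sum>m\<in>B n. b n m \<bullet> (\<Sigma> *v b n m))" for n
      by (intro sum_nonneg innovation_variance_nonneg)
  qed (measurable, rule that)
qed

text \<open>If \<open>D\<close> is the functional of the innovation and \<open>L\<close> that of the past, then the approximations of \<open>L\<close> do
not involve \<open>\<epsilon> s\<close>, so that the variance of \<open>D + L\<close> is the limit of sums of variances, namely
\<open>E D\<^sup>2 + E L\<^sup>2\<close>; the mixed term \<open>2 E (D L)\<close> must vanish.\<close>

lemma innovation_uncorrelated_past: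
  assumes K: "finite K" and past: "\<And>k. k \<in> K \<Longrightarrow> \<tau> k < s"
  shows "expectation (\<lambda>\<omega>. (d \<bullet> \<epsilon> s \<omega>) * (\<Sum>k\<in>K. c k \<bullet> y (\<tau> k) \<omega>)) = 0"
proof -
  define D where "D \<omega> = d \<bullet> \<epsilon> s \<omega>" for \<omega>
  define L where "L \<omega> = (\<Sum>k\<in>K. c k \<bullet> y (\<tau> k) \<omega>)" for \<omega>
  have [measurable]: "D \<in> borel_measurable P" "L \<in> borel_measurable P" unfolding D_def L_def by measurable
  define \<delta> where "\<delta> = d \<bullet> (\<Sigma> *v d)"
  have \<delta>: "\<delta> \<ge> 0" "distr P borel D = gauss \<delta>"
    using innovation_variance_nonneg innovation_distr by (auto simp: \<delta>_def D_def[abs_def])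
  obtain B b where B': "\<forall>n. finite (B n) \<and> B n \<subseteq> (\<Union>k\<in>K. {..\<tau> k})"
    and B: "AE \<omega> in P. (\<lambda>n. \<Sum>m\<in>B n. b n m \<bullet> \<epsilon> m \<omega>) \<longlonglongrightarrow> L \<omega>"
    using process_combination_approximation[OF K, of \<tau> c, folded L_def] by (elim exE conjE)
  have fin: "finite (B n)" for n using B' by simp
  have s: "s \<notin> B n" for n using B' past by force
  define v where "v n = (\<Sum>m\<in>B n. b n m \<bullet> (\<Sigma> *v b n m))" for n
  have v: "v n \<ge> 0" for n unfolding v_def by (intro sum_nonneg innovation_variance_nonneg)
  have vd: "distr P borel (\<lambda>\<omega>. \<Sum>m\<in>B n. b n m \<bullet> \<epsilon> m \<omega>) = gauss (v n)" for n
    unfolding v_def by (rule innovations_combination_distr[OF fin])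
  obtain w where w: "w \<ge> 0" "v \<longlonglongrightarrow> w" "distr P borel L = gauss w"
    by (rule AE_limit_of_gaussians[OF _ _ B v vd]) measurable
  have sum: "D \<omega> + (\<Sum>m\<in>B n. b n m \<bullet> \<epsilon> m \<omega>) = (\<Sum>m\<in>insert s (B n). ((b n)(s := d)) m \<bullet> \<epsilon> m \<omega>)" for n \<omega>
    using s[of n] fin[of n] by (auto simp: D_def intro!: sum.cong)
  have sum_v: "(\<Sum>m\<in>insert s (B n). ((b n)(s := d)) m \<bullet> (\<Sigma> *v ((b n)(s := d)) m)) = \<delta> + v n" for n
    using s[of n] fin[of n] by (auto simp: \<delta>_def v_def intro!: sum.cong)
  have sd: "distr P borel (\<lambda>\<omega>. D \<omega> + (\<Sum>m\<in>B n. b n m \<bullet> \<epsilon> m \<omega>)) = gauss (\<delta> + v n)" for n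
    unfolding sum using innovations_combination_distr[of "insert s (B n)" "(b n)(s := d)"] fin[of n]
    by (simp only: sum_v finite_insert)
  have lim: "AE \<omega> in P. (\<lambda>n. D \<omega> + (\<Sum>m\<in>B n. b n m \<bullet> \<epsilon> m \<omega>)) \<longlonglongrightarrow> D \<omega> + L \<omega>"
    using B by eventually_elim (intro tendsto_intros)
  have nn: "0 \<le> \<delta> + v n" for n using \<delta> v[of n] by simp
  obtain w' where w': "w' \<ge> 0" "(\<lambda>n. \<delta> + v n) \<longlonglongrightarrow> w'" "distr P borel (\<lambda>\<omega>. D \<omega> + L \<omega>) = gauss w'"
    by (rule AE_limit_of_gaussians[OF _ _ lim nn sd]) measurable
  have "w' = \<delta> + w"
    using LIMSEQ_unique[OF w'(2)] tendsto_add[OF tendsto_const w(2)] by blast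
  moreover have "integrable P (\<lambda>\<omega>. D \<omega> * L \<omega>)"
    using gauss_variable_square(1)[OF _ \<delta>(2,1)] gauss_variable_square(1)[OF _ w(3,1)]
    by (intro integrable_mult_of_squares) auto
  then have "expectation (\<lambda>\<omega>. (D \<omega> + L \<omega>)\<^sup>2) = \<delta> + w + 2 * expectation (\<lambda>\<omega>. D \<omega> * L \<omega>)"
    using gauss_variable_square[OF _ \<delta>(2,1)] gauss_variable_square[OF _ w(3,1)]
    by (simp add: power2_sum mult.assoc)
  moreover have "expectation (\<lambda>\<omega>. (D \<omega> + L \<omega>)\<^sup>2) = w'"
    by (rule gauss_variable_square(2)[OF _ w'(3,1)]) measurable
  ultimately show ?thesis by (simp add: D_def L_def)
qed

end

section \<open>Autocovariances of the stacked process\<close>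

text \<open>Expansion in the standard basis reduces the integral of a matrix-valued function to scalar integrals.\<close>

lemma integral_matrix_nth:
  fixes f :: "'a \<Rightarrow> real^'n^'m"
  assumes "\<And>i j. integrable M (\<lambda>\<omega>. f \<omega> $ i $ j)"
  shows "integral\<^sup>L M f $ i $ j = (\<integral>\<omega>. f \<omega> $ i $ j \<partial>M)"
proof -
  have matrix_eq: "(\<Sum>i\<in>UNIV. \<Sum>j\<in>UNIV. A i j *\<^sub>R axis i (axis j 1)) = (\<chi> i j. A i j)"
    for A :: "'m \<Rightarrow> 'n \<Rightarrow> real"
  proof -
    have "(\<Sum>j\<in>UNIV. A i j * (axis i (axis j 1 :: real^'n) :: real^'n^'m) $ a $ b) = (if i = a then A i b else 0)" for i a b
      by (simp add: axis_def if_distrib[of "\<lambda>x. _ * x"] cong: if_cong)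
    then show ?thesis by (simp add: vec_eq_iff)
  qed
  have "has_bochner_integral M (\<lambda>\<omega>. \<Sum>i\<in>UNIV. \<Sum>j\<in>UNIV. (f \<omega> $ i $ j) *\<^sub>R (axis i (axis j 1) :: real^'n^'m))
      (\<Sum>i\<in>UNIV. \<Sum>j\<in>UNIV. (\<integral>\<omega>. f \<omega> $ i $ j \<partial>M) *\<^sub>R axis i (axis j 1))"
    using assms by (intro has_bochner_integral_sum has_bochner_integral_scaleR_left has_bochner_integral_integrable)
  then have "has_bochner_integral M f (\<chi> i j. \<integral>\<omega>. f \<omega> $ i $ j \<partial>M)"
    by (simp add: matrix_eq)
  then show ?thesis by (simp add: has_bochner_integral_integral_eq)
qed

definition blk :: "real^('p::finite \<times> 'k::finite) \<Rightarrow> 'p \<Rightarrow> real^'k" where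
  "blk w a = (\<chi> i. w $ (a, i))"

lemma inner_Z:
  fixes w :: "real^('p::{finite,linorder} \<times> 'k::finite)"
  shows "w \<bullet> Z y t \<omega> = (\<Sum>a\<in>UNIV. blk w a \<bullet> y (t - int (lag a)) \<omega>)"
proof -
  have "w \<bullet> Z y t \<omega> = (\<Sum>(a, i)\<in>UNIV \<times> UNIV. w $ (a, i) * y (t - int (lag a)) \<omega> $ i)"
    by (auto simp: inner_vec_def Z_def UNIV_Times_UNIV[symmetric] simp del: UNIV_Times_UNIV intro!: sum.cong)
  also have "\<dots> = (\<Sum>a\<in>UNIV. \<Sum>i\<in>UNIV. w $ (a, i) * y (t - int (lag a)) \<omega> $ i)"
    by (rule sum.cartesian_product[symmetric])
  finally show ?thesis by (simp add: blk_def inner_vec_def)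
qed

text \<open>The innovation in the first block, zeros in the blocks of lag at least \<open>2\<close>.\<close>

definition impulse :: "real^'k \<Rightarrow> real^('p::{finite,linorder} \<times> 'k::finite)" where
  "impulse e = (\<chi> r. if lag (fst r) = 1 then e $ snd r else 0)"

lemma inner_impulse:
  fixes w :: "real^('p::{finite,linorder} \<times> 'k::finite)"
  shows "w \<bullet> impulse e = (\<Sum>a | lag a = 1. blk w a) \<bullet> e"
proof -
  have "w \<bullet> impulse e = (\<Sum>(a, i)\<in>UNIV \<times> UNIV. if lag a = 1 then w $ (a, i) * e $ i else 0)"
    by (auto simp: inner_vec_def impulse_def UNIV_Times_UNIV[symmetric] simp del: UNIV_Times_UNIV intro!: sum.cong)
  also have "\<dots> = (\<Sum>a\<in>UNIV. \<Sum>i\<in>UNIV. if lag a = 1 then w $ (a, i) * e $ i else 0)"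
    by (rule sum.cartesian_product[symmetric])
  also have "\<dots> = (\<Sum>a\<in>UNIV. if lag a = 1 then blk w a \<bullet> e else 0)"
    by (auto simp: blk_def inner_vec_def intro!: sum.cong)
  finally show ?thesis by (simp add: inner_sum_left sum.If_cases)
qed

lemma Z_recursion:
  fixes \<Phi> :: "nat \<Rightarrow> real^'k^'k"
  assumes "y t \<omega> = (\<Sum>l=1..CARD('p). \<Phi> l *v y (t - int l) \<omega>) + e"
  shows "(Z y (t + 1) \<omega> :: real^('p::{finite,linorder} \<times> 'k)) = companion \<Phi> *v Z y t \<omega> + impulse e"
proof -
  have lag_inj: "lag a = lag b \<longleftrightarrow> a = b" for a b :: 'p
    using bij_betw_lag[where 'p='p] by (auto simp: bij_betw_def inj_on_def)
  have lag_pos: "1 \<le> lag a" "lag a \<le> CARD('p)" for a :: 'p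
    using bij_betw_lag[where 'p='p] by (auto simp: bij_betw_def)
  have "(Z y (t + 1) \<omega> :: real^('p \<times> 'k)) $ (a, i) = (companion \<Phi> *v Z y t \<omega> + impulse e) $ (a, i)" for a i
  proof -
    have comp: "(companion \<Phi> *v (Z y t \<omega> :: real^('p \<times> 'k))) $ (a, i)
        = (\<Sum>b\<in>(UNIV :: 'p set). \<Sum>j\<in>UNIV. (if lag a = 1 then \<Phi> (lag b) $ i $ j
             else if lag a = lag b + 1 \<and> i = j then 1 else 0) * y (t - int (lag b)) \<omega> $ j)"
      unfolding sum.cartesian_product UNIV_Times_UNIV
      by (simp add: matrix_vector_mult_def companion_def Z_def) (auto intro!: sum.cong)
    show ?thesis
    proof (cases "lag a = 1")
      case True
      have "(\<Sum>b\<in>(UNIV :: 'p set). (\<Phi> (lag b) *v y (t - int (lag b)) \<omega>) $ i)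
          = (\<Sum>l=1..CARD('p). (\<Phi> l *v y (t - int l) \<omega>) $ i)"
        by (rule sum.reindex_bij_betw[OF bij_betw_lag])
      then show ?thesis
        using True assms by (simp add: comp) (simp add: Z_def impulse_def matrix_vector_mult_def)
    next
      case False
      then have "lag a - 1 \<in> {1..CARD('p)}" using lag_pos[of a] by auto
      then obtain b0 :: 'p where b0: "lag b0 = lag a - 1"
        using bij_betw_lag[where 'p='p] by (metis bij_betw_def imageE)
      have step: "lag a = lag b + 1 \<longleftrightarrow> b = b0" for b :: 'p
        using b0 lag_pos[of a] lag_inj[of b b0] by auto
      have inner: "(\<Sum>j\<in>UNIV. (if lag a = 1 then \<Phi> (lag b) $ i $ j
             else if lag a = lag b + 1 \<and> i = j then 1 else 0) * y (t - int (lag b)) \<omega> $ j)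
          = (if b = b0 then y (t - int (lag b)) \<omega> $ i else 0)" for b :: 'p
      proof (cases "b = b0")
        case True
        then show ?thesis
          using False unfolding step by (simp add: if_distrib[of "\<lambda>x. x * _"] cong: if_cong)
      next
        case neq: False
        then show ?thesis using False unfolding step by simp
      qed
      have time: "t - int (lag b0) = t + 1 - int (lag a)" using b0 lag_pos[of a] by simp
      have "(companion \<Phi> *v (Z y t \<omega> :: real^('p \<times> 'k))) $ (a, i) = y (t - int (lag b0)) \<omega> $ i"
        unfolding comp inner by simp
      then have "(companion \<Phi> *v (Z y t \<omega> :: real^('p \<times> 'k))) $ (a, i) = y (t + 1 - int (lag a)) \<omega> $ i"
        by (simp only: time)
      moreover have "(Z y (t + 1) \<omega> :: real^('p \<times> 'k)) $ (a, i) = y (t + 1 - int (lag a)) \<omega> $ i"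
        by (simp add: Z_def)
      ultimately show ?thesis using False by (simp add: impulse_def)
    qed
  qed
  then show ?thesis by (simp add: vec_eq_iff split_paired_all)
qed

lemma norm_matrix_vector_le: "norm (A *v x) \<le> spectral_norm A * norm (x :: real^'n)"
  unfolding spectral_norm_def by (rule onorm) (rule matrix_vector_mul_bounded_linear)

lemma spectral_norm_nonneg: "spectral_norm (A :: real^'n^'m) \<ge> 0"
  unfolding spectral_norm_def by (rule onorm_pos_le) (rule matrix_vector_mul_bounded_linear)

lemma inner_matrix_vector: "w \<bullet> (A *v v) = (\<Sum>i\<in>UNIV. \<Sum>j\<in>UNIV. (w $ i * v $ j) * A $ i $ j)"
  by (simp add: inner_vec_def matrix_vector_mult_def sum_distrib_left mult_ac)

context stationary_gaussian_var
begin

lemma inner_Z_measurable [measurable]: "(\<lambda>\<omega>. w \<bullet> Z y t \<omega>) \<in> borel_measurable P"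
  unfolding inner_Z by measurable

lemma Z_combination_gauss:
  fixes w :: "'r \<Rightarrow> real^('p::{finite,linorder} \<times> 'k)"
  assumes "finite R"
  shows "\<exists>v\<ge>0. distr P borel (\<lambda>\<omega>. \<Sum>r\<in>R. w r \<bullet> Z y (\<tau> r) \<omega>) = gauss v"
proof -
  have eq: "(\<Sum>r\<in>R. w r \<bullet> Z y (\<tau> r) \<omega>)
      = (\<Sum>k\<in>R \<times> (UNIV :: 'p set). blk (w (fst k)) (snd k) \<bullet> y (\<tau> (fst k) - int (lag (snd k))) \<omega>)" for \<omega>
    by (simp add: inner_Z sum.cartesian_product case_prod_beta)
  have "finite (R \<times> (UNIV :: 'p set))" using assms by simp
  from process_combination_gauss[OF this, of "\<lambda>k. blk (w (fst k)) (snd k)" "\<lambda>k. \<tau> (fst k) - int (lag (snd k))"]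
  show ?thesis unfolding eq by blast
qed

lemma inner_Z_square_integrable: "integrable P (\<lambda>\<omega>. (w \<bullet> Z y t \<omega>)\<^sup>2)"
proof -
  obtain v where "v \<ge> 0" "distr P borel (\<lambda>\<omega>. w \<bullet> Z y t \<omega>) = gauss v"
    using Z_combination_gauss[of "{()}" "\<lambda>_. w" "\<lambda>_. t"] by auto
  then show ?thesis by (intro gauss_variable_square(1)) auto
qed

lemma inner_Z_product_integrable: "integrable P (\<lambda>\<omega>. (w \<bullet> Z y t \<omega>) * (v \<bullet> Z y s \<omega>))"
  by (intro integrable_mult_of_squares inner_Z_square_integrable inner_Z_measurable)

lemma covariance_shift:
  "expectation (\<lambda>\<omega>. (w \<bullet> Z y (t + h) \<omega>) * (v \<bullet> Z y (s + h) \<omega>))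
   = expectation (\<lambda>\<omega>. (w \<bullet> Z y t \<omega>) * (v \<bullet> Z y s \<omega>))"
proof -
  define f where "f g = (\<Sum>a\<in>UNIV. blk w a \<bullet> g (t - int (lag a))) * (\<Sum>a\<in>UNIV. blk v a \<bullet> g (s - int (lag a)))"
    for g :: "int \<Rightarrow> real^'k"
  let ?N = "Pi\<^sub>M (UNIV :: int set) (\<lambda>_. borel :: (real^'k) measure)"
  have comp: "(\<lambda>g. g i) \<in> borel_measurable ?N" for i
    by (rule measurable_component_singleton) simp
  have fm: "f \<in> borel_measurable ?N"
    unfolding f_def by (intro borel_measurable_times borel_measurable_sum borel_measurable_inner comp borel_measurable_const)
  have ym: "(\<lambda>\<omega> t. y (t + c) \<omega>) \<in> P \<rightarrow>\<^sub>M ?N" for c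
    by (rule measurable_PiM_single') auto
  have distr: "distr P ?N (\<lambda>\<omega> t. y (t + h) \<omega>) = distr P ?N (\<lambda>\<omega> t. y t \<omega>)"
    using stationary by (simp add: strictly_stationary_def)
  have "expectation (\<lambda>\<omega>. (w \<bullet> Z y (t + h) \<omega>) * (v \<bullet> Z y (s + h) \<omega>))
      = expectation (\<lambda>\<omega>. f (\<lambda>t. y (t + h) \<omega>))"
    unfolding inner_Z f_def by (simp add: algebra_simps)
  also have "\<dots> = integral\<^sup>L (distr P ?N (\<lambda>\<omega> t. y (t + h) \<omega>)) f"
    by (rule integral_distr[OF ym fm, symmetric])
  also have "\<dots> = expectation (\<lambda>\<omega>. f (\<lambda>t. y t \<omega>))"
    unfolding distr using integral_distr[OF ym[of 0] fm] by simp
  also have "\<dots> = expectation (\<lambda>\<omega>. (w \<bullet> Z y t \<omega>) * (v \<bullet> Z y s \<omega>))"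
    unfolding inner_Z f_def ..
  finally show ?thesis .
qed

lemma nth_eq_inner_axis: "x $ i = axis i 1 \<bullet> (x :: real^'n)"
  by (simp add: inner_axis')

lemma Gam_nth:
  assumes "T \<ge> 1"
  shows "(Gam P y T :: real^('p::{finite,linorder} \<times> 'k)^('p \<times> 'k)) $ i $ j
    = expectation (\<lambda>\<omega>. (axis i 1 \<bullet> Z y t \<omega>) * (axis j 1 \<bullet> Z y t \<omega>))"
proof -
  have int: "integrable P (\<lambda>\<omega>. X y T \<omega> r $ i * X y T \<omega> r $ j)" for r and i j :: "'p \<times> 'k"
    using inner_Z_product_integrable[of "axis i 1" _ "axis j 1"]
    by (simp add: X_def nth_eq_inner_axis[symmetric])
  have shift: "t + (int T + 1 - int r - t) = int T + 1 - int r" for r by simp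
  have E: "expectation (\<lambda>\<omega>. X y T \<omega> r $ i * X y T \<omega> r $ j)
      = expectation (\<lambda>\<omega>. (axis i 1 \<bullet> Z y t \<omega>) * (axis j 1 \<bullet> Z y t \<omega>))" for r
    using covariance_shift[of "axis i 1" t "int T + 1 - int r - t" "axis j 1" t]
    unfolding shift by (simp add: X_def nth_eq_inner_axis[symmetric])
  have "(Gam P y T :: real^('p \<times> 'k)^('p \<times> 'k)) $ i $ j = expectation (\<lambda>\<omega>. Psi y T \<omega> $ i $ j)"
    unfolding Gam_def
    by (rule integral_matrix_nth) (simp add: Psi_def int del: times_divide_eq_left)
  also have "\<dots> = (1 / real T) * (\<Sum>r=1..T. expectation (\<lambda>\<omega>. X y T \<omega> r $ i * X y T \<omega> r $ j))"
    by (simp add: Psi_def int del: times_divide_eq_left)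
  also have "\<dots> = expectation (\<lambda>\<omega>. (axis i 1 \<bullet> Z y t \<omega>) * (axis j 1 \<bullet> Z y t \<omega>))"
    unfolding E using assms by simp
  finally show ?thesis .
qed

lemma covariance_lag_0:
  assumes "T \<ge> 1"
  shows "expectation (\<lambda>\<omega>. (w \<bullet> Z y t \<omega>) * (v \<bullet> Z y t \<omega>)) = w \<bullet> (Gam P y T *v v)"
proof -
  have "(w \<bullet> Z y t \<omega>) * (v \<bullet> Z y t \<omega>)
      = (\<Sum>i\<in>UNIV. \<Sum>j\<in>UNIV. (w $ i * v $ j) * ((axis i 1 \<bullet> Z y t \<omega>) * (axis j 1 \<bullet> Z y t \<omega>)))" for \<omega>
    unfolding inner_vec_def[of w] inner_vec_def[of v] sum_product nth_eq_inner_axis[symmetric]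
    by (simp add: mult_ac)
  then have "expectation (\<lambda>\<omega>. (w \<bullet> Z y t \<omega>) * (v \<bullet> Z y t \<omega>))
      = (\<Sum>i\<in>UNIV. \<Sum>j\<in>UNIV. (w $ i * v $ j) *
          expectation (\<lambda>\<omega>. (axis i 1 \<bullet> Z y t \<omega>) * (axis j 1 \<bullet> Z y t \<omega>)))"
    by (simp add: Bochner_Integration.integral_sum integrable_mult_right inner_Z_product_integrable)
  then show ?thesis by (simp only: inner_matrix_vector Gam_nth[OF assms, symmetric])
qed

text \<open>The Yule-Walker recursion, by induction on the lag: one step of \<open>Z_recursion\<close> moves the transposed companion
matrix to \<open>w\<close>, and the innovation contributes nothing because it is later than all entries of \<open>Z y t\<close>.\<close>

lemma covariance_lag:
  fixes w v :: "real^('p::{finite,linorder} \<times> 'k)"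
  assumes p: "p = CARD('p)" and T: "T \<ge> 1"
  shows "expectation (\<lambda>\<omega>. (w \<bullet> Z y (t + int h) \<omega>) * (v \<bullet> Z y t \<omega>))
       = w \<bullet> (matpow (companion \<Phi>) h *v (Gam P y T *v v))"
proof (induction h arbitrary: w)
  case 0
  show ?case using covariance_lag_0[OF T] by (simp add: matpow_def)
next
  case (Suc h)
  let ?F = "companion \<Phi> :: real^('p \<times> 'k)^('p \<times> 'k)"
  define s where "s = t + int h"
  define d where "d = (\<Sum>a | lag a = 1. blk w a)"
  have rec: "AE \<omega> in P. w \<bullet> Z y (t + int (Suc h)) \<omega> = (transpose ?F *v w) \<bullet> Z y s \<omega> + d \<bullet> \<epsilon> s \<omega>"
    using equation[of s]
  proof eventually_elim
    case (elim \<omega>)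
    have "(Z y (s + 1) \<omega> :: real^('p \<times> 'k)) = ?F *v Z y s \<omega> + impulse (\<epsilon> s \<omega>)"
      using elim p by (intro Z_recursion) simp
    moreover have next_time: "t + int (Suc h) = s + 1" by (simp add: s_def)
    moreover have "w \<bullet> (?F *v Z y s \<omega>) = (transpose ?F *v w) \<bullet> Z y s \<omega>"
      by (metis dot_lmul_matrix inner_commute transpose_matrix_vector)
    ultimately show ?case unfolding next_time by (simp add: inner_add_right inner_impulse d_def)
  qed
  have past: "expectation (\<lambda>\<omega>. (d \<bullet> \<epsilon> s \<omega>) * (v \<bullet> Z y t \<omega>)) = 0"
  proof -
    have lag_pos: "1 \<le> lag a" for a :: 'p
      using bij_betw_lag[where 'p='p] by (auto simp: bij_betw_def)
    show ?thesis unfolding inner_Z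
    proof (rule innovation_uncorrelated_past)
      fix a :: 'p show "t - int (lag a) < s" using lag_pos[of a] by (simp add: s_def)
    qed simp
  qed
  have int: "integrable P (\<lambda>\<omega>. (d \<bullet> \<epsilon> s \<omega>) * (v \<bullet> Z y t \<omega>))"
    by (intro integrable_mult_of_squares inner_Z_square_integrable inner_Z_measurable
        gauss_variable_square(1)[OF _ innovation_distr innovation_variance_nonneg]) measurable
  have "expectation (\<lambda>\<omega>. (w \<bullet> Z y (t + int (Suc h)) \<omega>) * (v \<bullet> Z y t \<omega>))
      = expectation (\<lambda>\<omega>. ((transpose ?F *v w) \<bullet> Z y s \<omega>) * (v \<bullet> Z y t \<omega>) + (d \<bullet> \<epsilon> s \<omega>) * (v \<bullet> Z y t \<omega>))"
  proof (rule integral_cong_AE)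
    show "AE \<omega> in P. (w \<bullet> Z y (t + int (Suc h)) \<omega>) * (v \<bullet> Z y t \<omega>)
      = ((transpose ?F *v w) \<bullet> Z y s \<omega>) * (v \<bullet> Z y t \<omega>) + (d \<bullet> \<epsilon> s \<omega>) * (v \<bullet> Z y t \<omega>)"
      using rec by eventually_elim (simp add: distrib_right)
  qed measurable
  also have "\<dots> = expectation (\<lambda>\<omega>. ((transpose ?F *v w) \<bullet> Z y s \<omega>) * (v \<bullet> Z y t \<omega>))"
    using past by (subst Bochner_Integration.integral_add[OF inner_Z_product_integrable int]) simp
  also have "\<dots> = (transpose ?F *v w) \<bullet> (matpow ?F h *v (Gam P y T *v v))"
    unfolding s_def by (rule Suc.IH)
  also have "\<dots> = w \<bullet> (?F *v (matpow ?F h *v (Gam P y T *v v)))"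
    by (metis dot_lmul_matrix inner_commute transpose_matrix_vector)
  also have "\<dots> = w \<bullet> (matpow ?F (Suc h) *v (Gam P y T *v v))"
    by (simp add: matpow_def matrix_vector_mul_assoc matrix_mul_assoc)
  finally show ?case .
qed

end

section \<open>Concentration of the sample covariance matrix\<close>

text \<open>In row \<open>r\<close> every distance \<open>i\<close> from the diagonal occurs at most once on each side.\<close>

lemma sum_lag_distance_le:
  fixes c :: "nat \<Rightarrow> real"
  assumes "\<And>i. c i \<ge> 0" and r: "r \<in> {1..T}"
  shows "(\<Sum>s=1..T. c (if s \<le> r then r - s else s - r)) \<le> 2 * (\<Sum>i=0..T. c i)"
proof -
  have le: "(\<Sum>s\<in>A. c (g s)) \<le> (\<Sum>i=0..T. c i)" if "inj_on g A" "g ` A \<subseteq> {0..T}" for g :: "nat \<Rightarrow> nat" and A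
  proof -
    have "(\<Sum>s\<in>A. c (g s)) = (\<Sum>i\<in>g ` A. c i)" using that by (simp add: sum.reindex)
    also have "\<dots> \<le> (\<Sum>i=0..T. c i)" using that assms by (intro sum_mono2) auto
    finally show ?thesis .
  qed
  have split: "{1..T} = {1..r} \<union> {r<..T}" using r by auto
  have "(\<Sum>s=1..T. c (if s \<le> r then r - s else s - r))
      = (\<Sum>s=1..r. c (r - s)) + (\<Sum>s\<in>{r<..T}. c (s - r))"
    unfolding split by (subst sum.union_disjoint) (auto intro!: arg_cong2[where f="(+)"] sum.cong)
  also have "\<dots> \<le> (\<Sum>i=0..T. c i) + (\<Sum>i=0..T. c i)"
    using r by (intro add_mono le) (auto simp: inj_on_def)
  finally show ?thesis by simp
qed

context stationary_gaussian_var
begin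

text \<open>Rows of \<open>X\<close> run backwards in time, so row \<open>r\<close> is later than row \<open>s\<close> if \<open>r < s\<close>. As the entry is
symmetric in \<open>r\<close> and \<open>s\<close>, the earlier of the two times can always be taken as the base.\<close>

lemma EXvvX_le:
  fixes v :: "real^('p::{finite,linorder} \<times> 'k)"
  assumes p: "p = CARD('p)" and T: "T \<ge> 1" and v: "norm v = 1"
  shows "\<bar>EXvvX P y T v r s\<bar> \<le> spectral_norm (Gam P y T :: real^('p \<times> 'k)^('p \<times> 'k)) *
     spectral_norm (matpow (companion \<Phi> :: real^('p \<times> 'k)^('p \<times> 'k)) (if s \<le> r then r - s else s - r))"
proof -
  let ?G = "Gam P y T :: real^('p \<times> 'k)^('p \<times> 'k)"
  let ?F = "companion \<Phi> :: real^('p \<times> 'k)^('p \<times> 'k)"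
  have bound: "\<bar>expectation (\<lambda>\<omega>. (v \<bullet> Z y (t + int h) \<omega>) * (v \<bullet> Z y t \<omega>))\<bar>
      \<le> spectral_norm ?G * spectral_norm (matpow ?F h)" for t h
  proof -
    have "\<bar>v \<bullet> (matpow ?F h *v (?G *v v))\<bar> \<le> norm (matpow ?F h *v (?G *v v))"
      using Cauchy_Schwarz_ineq2[of v "matpow ?F h *v (?G *v v)"] v by simp
    also have "\<dots> \<le> spectral_norm (matpow ?F h) * norm (?G *v v)" by (rule norm_matrix_vector_le)
    also have "\<dots> \<le> spectral_norm (matpow ?F h) * spectral_norm ?G"
      using norm_matrix_vector_le[of ?G v] v by (intro mult_left_mono spectral_norm_nonneg) simp
    finally show ?thesis unfolding covariance_lag[OF p T] by (simp only: mult.commute)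
  qed
  have E: "EXvvX P y T v r s = expectation (\<lambda>\<omega>. (v \<bullet> Z y (int T + 1 - int r) \<omega>) * (v \<bullet> Z y (int T + 1 - int s) \<omega>))"
    by (simp add: EXvvX_def X_def inner_commute)
  show ?thesis
  proof (cases "s \<le> r")
    case True
    then have "int T + 1 - int s = (int T + 1 - int r) + int (r - s)" by simp
    then show ?thesis using bound[of "int T + 1 - int r" "r - s"] True
      unfolding E by (simp only: if_True mult.commute)
  next
    case False
    then have "int T + 1 - int r = (int T + 1 - int s) + int (s - r)" by simp
    then show ?thesis using bound[of "int T + 1 - int s" "s - r"] False
      unfolding E by (simp only: if_False)
  qed
qed

lemma linf_norm_EXvvX_le:
  fixes v :: "real^('p::{finite,linorder} \<times> 'k)"
  assumes p: "p = CARD('p)" and T: "T \<ge> 1" and v: "norm v = 1"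
  shows "linf_norm T (EXvvX P y T v) \<le> 2 * spectral_norm (Gam P y T :: real^('p \<times> 'k)^('p \<times> 'k)) *
     (\<Sum>i=0..T. spectral_norm (matpow (companion \<Phi> :: real^('p \<times> 'k)^('p \<times> 'k)) i))"
proof -
  let ?G = "Gam P y T :: real^('p \<times> 'k)^('p \<times> 'k)"
  let ?c = "\<lambda>i. spectral_norm (matpow (companion \<Phi> :: real^('p \<times> 'k)^('p \<times> 'k)) i)"
  have "(\<Sum>s=1..T. \<bar>EXvvX P y T v r s\<bar>) \<le> 2 * spectral_norm ?G * (\<Sum>i=0..T. ?c i)" if r: "r \<in> {1..T}" for r
  proof -
    have "(\<Sum>s=1..T. \<bar>EXvvX P y T v r s\<bar>)
        \<le> (\<Sum>s=1..T. spectral_norm ?G * ?c (if s \<le> r then r - s else s - r))"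
      by (intro sum_mono EXvvX_le p T v)
    also have "\<dots> = spectral_norm ?G * (\<Sum>s=1..T. ?c (if s \<le> r then r - s else s - r))"
      by (rule sum_distrib_left[symmetric])
    also have "\<dots> \<le> spectral_norm ?G * (2 * (\<Sum>i=0..T. ?c i))"
      using r by (intro mult_left_mono sum_lag_distance_le spectral_norm_nonneg)
    finally show ?thesis by (simp only: mult_ac)
  qed
  then show ?thesis unfolding linf_norm_def using T by (subst Max_le_iff) auto
qed

lemma gaussian_family_X:
  fixes v :: "real^('p::{finite,linorder} \<times> 'k)"
  shows "gaussian_family P {1..T} (\<lambda>r \<omega>. X y T \<omega> r \<bullet> v) (EXvvX P y T v)"
proof unfold_locales
  have E: "EXvvX P y T v r s = expectation (\<lambda>\<omega>. (v \<bullet> Z y (int T + 1 - int r) \<omega>) * (v \<bullet> Z y (int T + 1 - int s) \<omega>))" for r s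
    by (simp add: EXvvX_def X_def inner_commute)
  have S: "X y T \<omega> r \<bullet> v = v \<bullet> Z y (int T + 1 - int r) \<omega>" for \<omega> r
    by (simp add: X_def inner_commute)
  show "(\<lambda>\<omega>. X y T \<omega> r \<bullet> v) \<in> borel_measurable P" for r unfolding S by (rule inner_Z_measurable)
  show "EXvvX P y T v r s = EXvvX P y T v s r" for r s by (simp add: E mult.commute)
  fix u :: "nat \<Rightarrow> real"
  define L where "L \<omega> = (\<Sum>r\<in>{1..T}. u r * (X y T \<omega> r \<bullet> v))" for \<omega>
  have L: "L \<omega> = (\<Sum>r\<in>{1..T}. (u r *\<^sub>R v) \<bullet> Z y (int T + 1 - int r) \<omega>)" for \<omega>
    by (simp add: L_def S)
  have [measurable]: "L \<in> borel_measurable P" unfolding L by (intro borel_measurable_sum inner_Z_measurable)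
  obtain w where w: "w \<ge> 0" "distr P borel L = gauss w"
    using Z_combination_gauss[of "{1..T}" "\<lambda>r. u r *\<^sub>R v" "\<lambda>r. int T + 1 - int r", folded L] by auto
  have "L \<omega> ^ 2 = (\<Sum>r=1..T. \<Sum>s=1..T. (u r * u s) *
      ((v \<bullet> Z y (int T + 1 - int r) \<omega>) * (v \<bullet> Z y (int T + 1 - int s) \<omega>)))" for \<omega>
    unfolding L power2_eq_square sum_product by (simp add: mult_ac)
  then have "expectation (\<lambda>\<omega>. L \<omega> ^ 2) = (\<Sum>r=1..T. \<Sum>s=1..T. (u r * u s) * EXvvX P y T v r s)"
    by (simp add: Bochner_Integration.integral_sum integrable_mult_right inner_Z_product_integrable E)
  also have "\<dots> = qform {1..T} (EXvvX P y T v) u"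
    by (simp add: qform_def mult_ac)
  finally have "w = qform {1..T} (EXvvX P y T v) u"
    using gauss_variable_square(2)[OF _ w(2,1)] by simp
  then show "0 \<le> qform {1..T} (EXvvX P y T v) u"
    "distr P borel (\<lambda>\<omega>. \<Sum>r\<in>{1..T}. u r * (X y T \<omega> r \<bullet> v)) = gauss (qform {1..T} (EXvvX P y T v) u)"
    using w by (simp_all add: L_def[abs_def])
qed simp

lemma Psi_quadratic_form:
  fixes v :: "real^('p::{finite,linorder} \<times> 'k)"
  shows "v \<bullet> (Psi y T \<omega> *v v) = (1 / real T) * (\<Sum>r=1..T. (X y T \<omega> r \<bullet> v)\<^sup>2)"
proof -
  have "v \<bullet> (Psi y T \<omega> *v v)
      = (\<Sum>i\<in>UNIV. \<Sum>j\<in>UNIV. \<Sum>r=1..T. (1 / real T) * ((X y T \<omega> r $ i * v $ i) * (X y T \<omega> r $ j * v $ j)))"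
    by (simp add: inner_matrix_vector Psi_def sum_distrib_left mult_ac)
  also have "\<dots> = (\<Sum>i\<in>UNIV. \<Sum>r=1..T. \<Sum>j\<in>UNIV. (1 / real T) * ((X y T \<omega> r $ i * v $ i) * (X y T \<omega> r $ j * v $ j)))"
    by (intro sum.cong refl sum.swap)
  also have "\<dots> = (\<Sum>r=1..T. \<Sum>i\<in>UNIV. \<Sum>j\<in>UNIV. (1 / real T) * ((X y T \<omega> r $ i * v $ i) * (X y T \<omega> r $ j * v $ j)))"
    by (rule sum.swap)
  also have "\<dots> = (1 / real T) * (\<Sum>r=1..T. (X y T \<omega> r \<bullet> v)\<^sup>2)"
    unfolding inner_vec_def power2_eq_square sum_product inner_real_def by (simp add: sum_distrib_left)
  finally show ?thesis .
qed

lemma Gam_quadratic_form: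
  fixes v :: "real^('p::{finite,linorder} \<times> 'k)"
  assumes "T \<ge> 1"
  shows "real T * (v \<bullet> (Gam P y T *v v)) = (\<Sum>r=1..T. EXvvX P y T v r r)"
proof -
  have "EXvvX P y T v r r = v \<bullet> (Gam P y T *v v)" for r
    using covariance_lag_0[OF assms, of v "int T + 1 - int r" v]
    by (simp add: EXvvX_def X_def inner_commute)
  then show ?thesis by simp
qed

lemma quadratic_form_measurable:
  "(\<lambda>\<omega>. v \<bullet> ((Psi y T \<omega> - Gam P y T) *v v)) \<in> borel_measurable P"
proof -
  have [measurable]: "(\<lambda>\<omega>. X y T \<omega> r \<bullet> v) \<in> borel_measurable P" for r
    unfolding X_def inner_commute[of _ v] by (rule inner_Z_measurable)
  show ?thesis
    unfolding matrix_vector_mult_diff_rdistrib inner_diff_right Psi_quadratic_form by measurable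
qed

lemma Gam_sym: "T \<ge> 1 \<Longrightarrow> Gam P y T $ i $ j = Gam P y T $ j $ i"
  by (simp only: Gam_nth[where t=0] mult.commute)

lemma quadratic_form_tail:
  fixes v :: "real^('p::{finite,linorder} \<times> 'k)"
  assumes T: "T \<ge> 1" and q: "linf_norm T (EXvvX P y T v) \<le> q" "q > 0" and tM: "t > 0" "M > 0"
  shows "prob {\<omega> \<in> space P. \<bar>v \<bullet> ((Psi y T \<omega> - Gam P y T) *v v)\<bar> > t}
    \<le> 2 * exp (- (t\<^sup>2 * real T) / (8 * q\<^sup>2 * M\<^sup>2)) + real T * exp (- M\<^sup>2 / 2)"
proof -
  interpret gaussian_family P "{1..T}" "\<lambda>r \<omega>. X y T \<omega> r \<bullet> v" "EXvvX P y T v"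
    by (rule gaussian_family_X)
  have rows: "(\<Sum>s=1..T. \<bar>EXvvX P y T v r s\<bar>) \<le> q" if "r \<in> {1..T}" for r
  proof -
    have "(\<Sum>s=1..T. \<bar>EXvvX P y T v r s\<bar>) \<le> linf_norm T (EXvvX P y T v)"
      unfolding linf_norm_def using that by (intro Max_ge) auto
    then show ?thesis using q by simp
  qed
  have eq: "v \<bullet> ((Psi y T \<omega> - Gam P y T) *v v)
      = ((\<Sum>r=1..T. (X y T \<omega> r \<bullet> v)\<^sup>2) - (\<Sum>r=1..T. EXvvX P y T v r r)) / real T" for \<omega>
  proof -
    have "v \<bullet> ((Psi y T \<omega> - Gam P y T) *v v) = v \<bullet> (Psi y T \<omega> *v v) - v \<bullet> (Gam P y T *v v)"
      by (simp add: matrix_vector_mult_diff_rdistrib inner_diff_right)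
    also have "v \<bullet> (Gam P y T *v v) = (\<Sum>r=1..T. EXvvX P y T v r r) / real T"
      using Gam_quadratic_form[OF T, of v] T by (simp add: field_simps)
    finally show ?thesis by (simp add: Psi_quadratic_form diff_divide_distrib)
  qed
  have "(\<bar>v \<bullet> ((Psi y T \<omega> - Gam P y T) *v v)\<bar> > t)
      \<longleftrightarrow> \<bar>(\<Sum>r=1..T. (X y T \<omega> r \<bullet> v)\<^sup>2) - (\<Sum>r=1..T. EXvvX P y T v r r)\<bar> > real (card {1..T}) * t" for \<omega>
    unfolding eq using T by (simp add: abs_divide pos_less_divide_eq mult.commute)
  then show ?thesis using sum_squares_tail[OF _ rows q(2) tM] T by simp
qed

end

text \<open>The form at \<open>e\<^sub>i + e\<^sub>j\<close> minus that at \<open>e\<^sub>i - e\<^sub>j\<close> is four times the entry, and scaling both vectors to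
length \<open>1\<close> halves it. So if the entry exceeds \<open>t\<close> in absolute value, one of the two forms does.\<close>

lemma symmetric_matrix_polarization:
  fixes A :: "real^'n^'n"
  assumes sym: "A $ j $ i = A $ i $ j"
  shows "2 * A $ i $ j = ((1 / sqrt 2) *\<^sub>R (axis i 1 + axis j 1)) \<bullet> (A *v ((1 / sqrt 2) *\<^sub>R (axis i 1 + axis j 1)))
    - ((1 / sqrt 2) *\<^sub>R (axis i 1 - axis j 1)) \<bullet> (A *v ((1 / sqrt 2) *\<^sub>R (axis i 1 - axis j 1)))"
proof -
  have ax: "axis a 1 \<bullet> (A *v axis b 1) = A $ a $ b" for a b
    by (simp add: inner_axis' matrix_vector_mult_basis column_def)
  have half: "((1 / sqrt 2) *\<^sub>R x) \<bullet> (A *v ((1 / sqrt 2) *\<^sub>R x)) = (x \<bullet> (A *v x)) / 2" for x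
    by (simp add: matrix_vector_mult_scaleR)
  show ?thesis unfolding half
    by (simp add: matrix_vector_right_distrib matrix_vector_mult_diff_distrib inner_add_left inner_add_right
        inner_diff_left inner_diff_right ax sym field_simps)
qed

lemma norm_polarization_vectors:
  assumes "i \<noteq> (j :: 'n::finite)"
  shows "norm ((1 / sqrt 2) *\<^sub>R (axis i 1 + axis j 1) :: real^'n) = 1"
    and "norm ((1 / sqrt 2) *\<^sub>R (axis i 1 - axis j 1) :: real^'n) = 1"
proof -
  have "(axis i 1 :: real^'n) \<bullet> axis j 1 = 0" using assms by (simp add: inner_axis_axis)
  then have "(axis i 1 + axis j 1 :: real^'n) \<bullet> (axis i 1 + axis j 1) = 2"
    "(axis i 1 - axis j 1 :: real^'n) \<bullet> (axis i 1 - axis j 1) = 2"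
    by (simp_all add: inner_add_left inner_add_right inner_diff_left inner_diff_right inner_axis_axis inner_commute)
  then show "norm ((1 / sqrt 2) *\<^sub>R (axis i 1 + axis j 1) :: real^'n) = 1"
    "norm ((1 / sqrt 2) *\<^sub>R (axis i 1 - axis j 1) :: real^'n) = 1"
    by (simp_all add: norm_eq_sqrt_inner[of "_ + _"] norm_eq_sqrt_inner[of "_ - _"])
qed

theorem lemma8:
  fixes P :: "'a measure"
    and \<Phi> :: "nat \<Rightarrow> real^'k^'k" and \<Sigma> :: "real^'k^'k"
    and \<epsilon> y :: "int \<Rightarrow> 'a \<Rightarrow> real^'k"
    and T :: nat and t M :: real
    and \<Psi> :: "'a \<Rightarrow> real^('p::{finite,linorder} \<times> 'k)^('p \<times> 'k)"
    and \<Gamma> F :: "real^('p \<times> 'k)^('p \<times> 'k)"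
    and Qnorm :: real
  defines "\<Psi> \<equiv> Psi y T"
    and "\<Gamma> \<equiv> Gam P y T"
    and "F \<equiv> companion \<Phi>"
    and "Qnorm \<equiv> (SUP v\<in>{v :: real^('p \<times> 'k). norm v = 1}. linf_norm T (EXvvX P y T v))"
  assumes "stationary_gaussian_var P CARD('p) \<Phi> \<Sigma> \<epsilon> y"
    and "T \<ge> 1" and "t > 0" and "M > 0"
  shows "measure P {\<omega> \<in> space P. Max (range (\<lambda>(i, j). \<bar>\<Psi> \<omega> $ i $ j - \<Gamma> $ i $ j\<bar>)) > t}
           \<le> 2 * real CARD('k)^2 * real CARD('p)^2 *
              (2 * exp (- (t^2 * real T) / (8 * Qnorm^2 * M^2)) + real T * exp (- (M^2) / 2))
           \<and> Qnorm \<le> 2 * spectral_norm \<Gamma> * (\<Sum>i=0..T. spectral_norm (matpow F i))"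
proof
  interpret stationary_gaussian_var P "CARD('p)" \<Phi> \<Sigma> \<epsilon> y by fact
  let ?U = "{v :: real^('p \<times> 'k). norm v = 1}"
  have le: "linf_norm T (EXvvX P y T v) \<le> 2 * spectral_norm \<Gamma> * (\<Sum>i=0..T. spectral_norm (matpow F i))"
    if "v \<in> ?U" for v
    unfolding \<Gamma>_def F_def using that assms(6) by (intro linf_norm_EXvvX_le) auto
  have unit: "axis i 1 \<in> ?U" for i by simp
  show "Qnorm \<le> 2 * spectral_norm \<Gamma> * (\<Sum>i=0..T. spectral_norm (matpow F i))"
    unfolding Qnorm_def by (rule cSUP_least[OF _ le]) (use unit in blast)
  have upper: "linf_norm T (EXvvX P y T v) \<le> Qnorm" if "v \<in> ?U" for v
    unfolding Qnorm_def by (rule cSUP_upper[OF that]) (use le in \<open>auto intro!: bdd_aboveI2\<close>)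
  let ?b = "2 * exp (- (t^2 * real T) / (8 * Qnorm^2 * M^2)) + real T * exp (- (M^2) / 2)"
  let ?E = "{\<omega> \<in> space P. Max (range (\<lambda>(i, j). \<bar>\<Psi> \<omega> $ i $ j - \<Gamma> $ i $ j\<bar>)) > t}"
  have cards: "1 \<le> real CARD('k)" "1 \<le> real CARD('p)" by (simp_all add: Suc_le_eq)
  show "measure P ?E \<le> 2 * real CARD('k)^2 * real CARD('p)^2 * ?b"
  \<comment> \<open>for \<open>Qnorm = 0\<close> the quotient in the exponent is \<open>0\<close> by convention and the right-hand side exceeds \<open>1\<close>\<close>
  proof (cases "Qnorm = 0")
    case True
    have large: "1 * 1 \<le> (2 * (real CARD('k)^2 * real CARD('p)^2)) * ?b"
    proof (rule mult_mono)
      have "1 * 1 \<le> real CARD('k)^2 * real CARD('p)^2"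
        using cards by (intro mult_mono one_le_power) auto
      then show "1 \<le> 2 * (real CARD('k)^2 * real CARD('p)^2)" by simp
      have "0 \<le> real T * exp (- (M^2) / 2)" by simp
      then show "1 \<le> ?b" using True by simp
    qed auto
    have "prob ?E \<le> 1" by (rule prob_le_1)
    also have "1 \<le> 2 * real CARD('k)^2 * real CARD('p)^2 * ?b"
      using large by (simp only: mult.assoc mult_1)
    finally show ?thesis .
  next
    case False
    have "0 \<le> linf_norm T (EXvvX P y T v)" for v :: "real^('p \<times> 'k)"
    proof -
      have "0 \<le> (\<Sum>s=1..T. \<bar>EXvvX P y T v 1 s\<bar>)" by (intro sum_nonneg) auto
      also have "\<dots> \<le> linf_norm T (EXvvX P y T v)"
        unfolding linf_norm_def using assms(6) by (intro Max_ge) auto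
      finally show ?thesis .
    qed
    then have "0 \<le> Qnorm" using upper[OF unit] order_trans by blast
    then have Q: "Qnorm > 0" using False by simp
    define A where "A \<omega> = \<Psi> \<omega> - \<Gamma>" for \<omega>
    define D where "D v = {\<omega> \<in> space P. \<bar>v \<bullet> (A \<omega> *v v)\<bar> > t}" for v
    have A_sym: "A \<omega> $ j $ i = A \<omega> $ i $ j" for \<omega> i j
      using Gam_sym[OF assms(6), of j i] by (simp add: A_def \<Psi>_def \<Gamma>_def Psi_def mult.commute)
    have D_meas: "D v \<in> events" for v
      using quadratic_form_measurable[of v T] unfolding D_def A_def \<Psi>_def \<Gamma>_def by measurable
    have D_prob: "prob (D v) \<le> ?b" if "v \<in> ?U" for v
      unfolding D_def A_def \<Psi>_def \<Gamma>_def
      using quadratic_form_tail[OF assms(6) upper[OF that] Q assms(7,8)] .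
    \<comment> \<open>on the diagonal no polarization is needed, and \<open>e\<^sub>i - e\<^sub>i\<close> would not be a unit vector\<close>
    define u where "u i j = (if i = j then axis i 1 else (1 / sqrt 2) *\<^sub>R (axis i 1 + axis j 1) :: real^('p \<times> 'k))"
      for i j :: "'p \<times> 'k"
    define w where "w i j = (if i = j then axis i 1 else (1 / sqrt 2) *\<^sub>R (axis i 1 - axis j 1) :: real^('p \<times> 'k))"
      for i j :: "'p \<times> 'k"
    have "norm (u i j) = 1 \<and> norm (w i j) = 1" for i j
    proof (cases "i = j")
      case True
      then show ?thesis by (simp add: u_def w_def)
    next
      case False
      then show ?thesis
        using norm_polarization_vectors[OF False] by (simp only: u_def w_def if_False simp_thms)
    qed
    then have uw: "u i j \<in> ?U" "w i j \<in> ?U" for i j by simp_all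
    have entry: "\<omega> \<in> D (u i j) \<union> D (w i j)" if "\<omega> \<in> space P" "\<bar>A \<omega> $ i $ j\<bar> > t" for \<omega> i j
    proof (cases "i = j")
      case True
      have "axis i 1 \<bullet> (A \<omega> *v axis i 1) = A \<omega> $ i $ i"
        by (simp add: inner_axis' matrix_vector_mult_basis column_def)
      then show ?thesis using that True by (simp add: D_def u_def)
    next
      case False
      have "2 * A \<omega> $ i $ j = u i j \<bullet> (A \<omega> *v u i j) - w i j \<bullet> (A \<omega> *v w i j)"
        using symmetric_matrix_polarization[of "A \<omega>" j i] A_sym False by (simp only: u_def w_def if_False)
      then have "\<bar>u i j \<bullet> (A \<omega> *v u i j)\<bar> > t \<or> \<bar>w i j \<bullet> (A \<omega> *v w i j)\<bar> > t"
        using that(2) by linarith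
      then show ?thesis using that(1) by (auto simp: D_def)
    qed
    have "?E \<subseteq> (\<Union>(i, j)\<in>UNIV. D (u i j) \<union> D (w i j))"
    proof clarify
      fix \<omega> assume \<omega>: "\<omega> \<in> space P" "Max (range (\<lambda>(i, j). \<bar>\<Psi> \<omega> $ i $ j - \<Gamma> $ i $ j\<bar>)) > t"
      then obtain i j where "\<bar>A \<omega> $ i $ j\<bar> > t"
        by (subst (asm) Max_gr_iff) (auto simp: A_def)
      then show "\<omega> \<in> (\<Union>(i, j)\<in>UNIV. D (u i j) \<union> D (w i j))" using entry[OF \<omega>(1)] by blast
    qed
    then have "prob ?E \<le> prob (\<Union>(i, j)\<in>UNIV. D (u i j) \<union> D (w i j))"
      using D_meas by (intro finite_measure_mono) (auto intro!: sets.finite_UN)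
    also have "\<dots> \<le> (\<Sum>(i, j)\<in>UNIV. prob (D (u i j) \<union> D (w i j)))"
      using D_meas finite_measure_subadditive_finite[of UNIV "\<lambda>(i, j). D (u i j) \<union> D (w i j)"]
      by (auto simp: case_prod_beta)
    also have "\<dots> \<le> (\<Sum>(i, j)\<in>(UNIV :: (('p \<times> 'k) \<times> ('p \<times> 'k)) set). 2 * ?b)"
    proof (intro sum_mono, clarify)
      fix i j :: "'p \<times> 'k"
      have "prob (D (u i j) \<union> D (w i j)) \<le> prob (D (u i j)) + prob (D (w i j))"
        by (intro measure_Un_le D_meas)
      also have "\<dots> \<le> ?b + ?b" by (intro add_mono D_prob uw)
      finally show "prob (D (u i j) \<union> D (w i j)) \<le> 2 * ?b" by simp
    qed
    also have "\<dots> = 2 * real CARD('k)^2 * real CARD('p)^2 * ?b"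
      by (simp add: case_prod_beta power2_eq_square mult_ac)
    finally show ?thesis .
  qed
qed

end
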